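(* Let $v$ be a nonconstant real analytic function on $\mathbb{T}=\mathbb{R}/\mathbb{Z}$. For every $\kappa>0$ there exists $\lambda_0=\lambda_0(v,\kappa)$, depending only on $v$ and $\kappa$, such that the following holds. Let $(\mathbb{Y},\mathscr{B},m)$ be a probability space and let $T:\mathbb{T}\times\mathbb{Y}\to\mathbb{T}\times\mathbb{Y}$ be a measure preserving transformation of the form $T(x,y)=(x+f(y),g(y))$ with $g:\mathbb{Y}\to\mathbb{Y}$ and $f:\mathbb{Y}\to\mathbb{T}$. If $\lambda>\lambda_0$ and $E$ is in the spectrum of the Schrödinger operator $S_{(x,y),\lambda v}$ (for some $(x,y)\in\mathbb{T}\times\mathbb{Y}$), then the Lyapunov exponent satisfies $$(1-\kappa)\log\lambda<L(E)<(1+\kappa)\log\lambda .$$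
   Context: $\mathbb{T}$ carries its Haar (Lebesgue) probability measure, $\mathbb{T}\times\mathbb{Y}$ carries the product measure, $f$ and $g$ are measurable, and $\pi_{\mathbb{T}}:\mathbb{T}\times\mathbb{Y}\to\mathbb{T}$ is the projection onto the first factor. The operator $S_{(x,y),\lambda v}$ acts on $\ell^2(\mathbb{Z}^+)$ by $$(S_{(x,y),\lambda v}\phi)(n)=\phi(n+1)+\phi(n-1)+\lambda v(\pi_{\mathbb{T}}(T^n(x,y)))\phi(n),\qquad n\ge 1,$$ with the convention $\phi(0)=0$. The transfer matrix is the ordered product (factor $j=n$ leftmost, $j=1$ rightmost) $$M_n(x,y,E)=\prod_{j=n}^{1}\begin{pmatrix}E-\lambda v(\pi_{\mathbb{T}}(T^j(x,y)))&-1\\1&0\end{pmatrix},$$ and $$L_n(E)=\frac1n\int_{\mathbb{Y}}\int_{\mathbb{T}}\log\|M_n(x,y,E)\|\,dx\,dm(y),\qquad L(E)=\lim_{n\to\infty}L_n(E),$$ the limit existing by subadditivity. $L(E)$ is called the Lyapunov exponent. *)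

theory Defs
  imports "HOL-Probability.Probability"
begin

text \<open>
  The circle is represented by the fundamental domain \<open>{0..<1}\<close>, with addition modulo 1 and
  Lebesgue measure. A function on the circle is a function on the reals with period 1.
\<close>

definition circle :: "real measure" where
  "circle = restrict_space lborel {0..<1}"

definition real_analytic :: "(real \<Rightarrow> real) \<Rightarrow> bool" where
  "real_analytic v \<longleftrightarrow>
     (\<forall>x0. \<exists>r>0. \<exists>a :: nat \<Rightarrow> real. \<forall>x. \<bar>x - x0\<bar> < r \<longrightarrow> (\<lambda>n. a n * (x - x0) ^ n) sums v x)"

definition periodic1 :: "(real \<Rightarrow> real) \<Rightarrow> bool" where
  "periodic1 v \<longleftrightarrow> (\<forall>x. v (x + 1) = v x)"

definition skew_shift :: "('y \<Rightarrow> real) \<Rightarrow> ('y \<Rightarrow> 'y) \<Rightarrow> real \<times> 'y \<Rightarrow> real \<times> 'y" where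
  "skew_shift f g = (\<lambda>(x, y). (frac (x + f y), g y))"

definition measure_preserving :: "'a measure \<Rightarrow> ('a \<Rightarrow> 'a) \<Rightarrow> bool" where
  "measure_preserving N T \<longleftrightarrow> T \<in> measurable N N \<and> distr N N T = N"

text \<open>
  The complex space \<open>\<ell>\<^sup>2\<close> over the positive integers. Its elements are extended by \<open>\<phi> 0 = 0\<close>,
  which builds the boundary condition into the carrier.
\<close>

definition ell2 :: "(nat \<Rightarrow> complex) set" where
  "ell2 = {\<phi>. \<phi> 0 = 0 \<and> summable (\<lambda>n. (cmod (\<phi> n))\<^sup>2)}"

definition ell2_norm :: "(nat \<Rightarrow> complex) \<Rightarrow> real" where
  "ell2_norm \<phi> = sqrt (\<Sum>n. (cmod (\<phi> n))\<^sup>2)"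

text \<open>
  Spectrum of a linear operator \<open>A\<close> on \<open>ell2\<close>: the \<open>z\<close> for which \<open>A - z\<close> has no bounded
  two-sided inverse \<open>R\<close>. Linearity of \<open>R\<close> is automatic.
\<close>

definition ell2_spectrum :: "((nat \<Rightarrow> complex) \<Rightarrow> nat \<Rightarrow> complex) \<Rightarrow> complex set" where
  "ell2_spectrum A = {z. \<not> (\<exists>R C.
      (\<forall>\<phi>\<in>ell2. R \<phi> \<in> ell2 \<and> ell2_norm (R \<phi>) \<le> C * ell2_norm \<phi>) \<and>
      (\<forall>\<phi>\<in>ell2. R (\<lambda>n. A \<phi> n - z * \<phi> n) = \<phi>) \<and>
      (\<forall>\<phi>\<in>ell2. (\<lambda>n. A (R \<phi>) n - z * R \<phi> n) = \<phi>))}"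

definition schroedinger ::
  "(real \<times> 'y \<Rightarrow> real \<times> 'y) \<Rightarrow> (real \<Rightarrow> real) \<Rightarrow> real \<Rightarrow> real \<times> 'y
     \<Rightarrow> (nat \<Rightarrow> complex) \<Rightarrow> nat \<Rightarrow> complex" where
  "schroedinger T v lam p \<phi> n =
     (if n = 0 then 0
      else \<phi> (n + 1) + \<phi> (n - 1) + complex_of_real (lam * v (fst ((T ^^ n) p))) * \<phi> n)"

fun transfer_matrix ::
  "(real \<times> 'y \<Rightarrow> real \<times> 'y) \<Rightarrow> (real \<Rightarrow> real) \<Rightarrow> real \<Rightarrow> real \<Rightarrow> nat \<Rightarrow> real \<times> 'y \<Rightarrow> real^2^2" where
  "transfer_matrix T v lam E 0 p = mat 1"
| "transfer_matrix T v lam E (Suc n) p =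
     (vector [vector [E - lam * v (fst ((T ^^ Suc n) p)), -1], vector [1, 0]] :: real^2^2)
       ** transfer_matrix T v lam E n p"

definition lyapunov_n ::
  "'y measure \<Rightarrow> (real \<times> 'y \<Rightarrow> real \<times> 'y) \<Rightarrow> (real \<Rightarrow> real) \<Rightarrow> real \<Rightarrow> real \<Rightarrow> nat \<Rightarrow> real" where
  "lyapunov_n M T v lam E n =
     1 / real n *
       (LINT y|M. (LINT x|circle. ln (onorm (\<lambda>w. transfer_matrix T v lam E n (x, y) *v w))))"

definition lyapunov ::
  "'y measure \<Rightarrow> (real \<times> 'y \<Rightarrow> real \<times> 'y) \<Rightarrow> (real \<Rightarrow> real) \<Rightarrow> real \<Rightarrow> real \<Rightarrow> real" where
  "lyapunov M T v lam E = lim (\<lambda>n. lyapunov_n M T v lam E n)"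

text \<open>
  \<open>valid_threshold TYPE('y) v \<kappa> l\<close>: the Lyapunov exponent bounds hold above the coupling \<open>l\<close> for
  all systems over probability spaces on the type \<open>'y\<close>.
\<close>

definition valid_threshold :: "'y itself \<Rightarrow> (real \<Rightarrow> real) \<Rightarrow> real \<Rightarrow> real \<Rightarrow> bool" where
  "valid_threshold _ v \<kappa> l \<longleftrightarrow>
     (\<forall>(M :: 'y measure) f g x y lam E.
        prob_space M \<longrightarrow> f \<in> measurable M circle \<longrightarrow> g \<in> measurable M M \<longrightarrow>
        measure_preserving (circle \<Otimes>\<^sub>M M) (skew_shift f g) \<longrightarrow>
        x \<in> space circle \<longrightarrow> y \<in> space M \<longrightarrow> lam > l \<longrightarrow>
        complex_of_real E \<in> ell2_spectrum (schroedinger (skew_shift f g) v lam (x, y)) \<longrightarrow>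
        (1 - \<kappa>) * ln lam < lyapunov M (skew_shift f g) v lam E \<and>
        lyapunov M (skew_shift f g) v lam E < (1 + \<kappa>) * ln lam)"

text \<open>
  A threshold that depends only on \<open>v\<close> and \<open>\<kappa>\<close>. An existential quantifier in a theorem with a type
  variable \<open>'y\<close> for the base space would let the threshold depend on \<open>'y\<close>; the type of this
  constant does not mention \<open>'y\<close>, so one value must serve the base spaces over all types.

  The choice is made on base spaces of real sequences. Nothing is lost: the map sending \<open>y\<close> to the
  sequence \<open>f (g\<^sup>k y)\<close>, indexed by \<open>k\<close>, carries any system to one over such a base (with the first
  coordinate as \<open>f\<close> and the left shift as \<open>g\<close>) with the same operators and the same Lyapunov
  exponents, so a threshold valid there is valid over every type.
\<close>

definition lambda0 :: "(real \<Rightarrow> real) \<Rightarrow> real \<Rightarrow> real" where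
  "lambda0 v \<kappa> = (SOME l. valid_threshold TYPE(nat \<Rightarrow> real) v \<kappa> l)"

end

theory Submission
  imports Defs "HOL-Complex_Analysis.Conformal_Mappings"
begin

text \<open>
  The lower bound holds for every fiber \<open>y\<close> and every length \<open>n\<close>. Extend \<open>v\<close> to a holomorphic function
  on a strip around the real line. The upper left entry \<open>P\<close> of the transfer matrix of length \<open>n\<close> is
  a continuant, hence holomorphic in the phase, and with \<open>e = E / \<lambda>\<close> it is at most \<open>(C \<lambda>) ^ n\<close> on
  a line \<open>Im z = \<rho>\<close> and at least \<open>(c \<lambda>) ^ n\<close> on a line \<open>Im z = t\<close>, \<open>0 < t < \<rho>\<close>, that avoids the
  zeros of \<open>v - e\<close>. Apply the maximum principle to the product of the translates \<open>P (z + k / N)\<close>,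
  \<open>k < N\<close>, times \<open>exp (i b n N z)\<close>, with \<open>b\<close> so large that the line \<open>Im z = \<rho>\<close> loses against
  \<open>Im z = t\<close>: some Riemann sum of \<open>log \<bar>P\<bar>\<close> over the real line is at least \<open>n (log \<lambda> - C')\<close>.
  Since \<open>log \<bar>P\<bar>\<close> is below the continuous function \<open>log \<parallel>M\<^sub>n\<parallel>\<close>, letting \<open>N\<close> grow gives the bound for
  the integral. Neither \<open>b\<close> nor \<open>C'\<close> depends on \<open>\<lambda>\<close>, and compactness makes \<open>C'\<close> uniform in \<open>e\<close>.
  The upper bound is the product of the norms of the factors, because \<open>\<bar>E\<bar> \<le> 2 + \<lambda> sup \<bar>v\<bar>\<close> on the spectrum.
\<close>

section \<open>The spectrum is bounded by the norm of the operator\<close>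

text \<open>The diagonal dominates the two neighbours. Norms over \<open>n < N\<close> give
  \<open>(2 + \<delta>) * S N \<le> 2 * S N + cmod (\<psi> N) + ell2_norm \<phi>\<close>, where
  \<open>\<psi> N\<close> comes from the cut at \<open>N\<close>.\<close>

lemma jacobi_bounded_solution_ell2:
  fixes D \<psi> \<phi> :: "nat \<Rightarrow> complex"
  assumes \<delta>: "\<delta> > 0" and D: "\<And>n. n \<ge> 1 \<Longrightarrow> cmod (D n) \<ge> 2 + \<delta>"
    and \<psi>0: "\<psi> 0 = 0" and bd: "\<And>n. cmod (\<psi> n) \<le> K" and \<phi>: "\<phi> \<in> ell2"
    and eq: "\<And>n. n \<ge> 1 \<Longrightarrow> D n * \<psi> n = \<psi> (n + 1) + \<psi> (n - 1) - \<phi> n"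
  shows "\<psi> \<in> ell2" and "\<delta> * ell2_norm \<psi> \<le> ell2_norm \<phi>"
proof -
  define S where "S N = L2_set (\<lambda>n. cmod (\<psi> n)) {..<N}" for N
  have sum_phi: "summable (\<lambda>n. (cmod (\<phi> n))\<^sup>2)" using \<phi> by (simp add: ell2_def)
  have main: "\<delta> * S N \<le> ell2_norm \<phi> + cmod (\<psi> N)" for N
  proof -
    have pt: "(2 + \<delta>) * cmod (\<psi> n) \<le> cmod (\<psi> (n + 1)) + (cmod (\<psi> (n - 1)) + cmod (\<phi> n))" for n
    proof (cases "n = 0")
      case False
      have "(2 + \<delta>) * cmod (\<psi> n) \<le> cmod (D n * \<psi> n)"
        using D[of n] False by (simp add: norm_mult mult_right_mono)
      also have "\<dots> \<le> cmod (\<psi> (n + 1)) + (cmod (\<psi> (n - 1)) + cmod (\<phi> n))"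
        using False by (smt (verit) eq less_one linorder_not_le norm_triangle_ineq norm_triangle_ineq4)
      finally show ?thesis .
    qed (simp add: \<psi>0)
    have "(2 + \<delta>) * S N = L2_set (\<lambda>n. (2 + \<delta>) * cmod (\<psi> n)) {..<N}"
      unfolding S_def using \<delta> by (simp add: L2_set_right_distrib)
    also have "\<dots> \<le> L2_set (\<lambda>n. cmod (\<psi> (n + 1)) + (cmod (\<psi> (n - 1)) + cmod (\<phi> n))) {..<N}"
      using \<delta> by (intro L2_set_mono pt) auto
    also have "\<dots> \<le> L2_set (\<lambda>n. cmod (\<psi> (n + 1))) {..<N} +
       (L2_set (\<lambda>n. cmod (\<psi> (n - 1))) {..<N} + L2_set (\<lambda>n. cmod (\<phi> n)) {..<N})"
      by (rule order_trans[OF L2_set_triangle_ineq add_left_mono[OF L2_set_triangle_ineq]])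
    also have "L2_set (\<lambda>n. cmod (\<psi> (n + 1))) {..<N} \<le> L2_set (\<lambda>n. cmod (\<psi> n)) {..<Suc N}"
      unfolding L2_set_def by (simp add: sum.lessThan_Suc_shift del: sum.lessThan_Suc)
    also have "\<dots> \<le> S N + cmod (\<psi> N)"
      unfolding S_def lessThan_Suc by (simp add: sqrt_sum_squares_le_sum add.commute)
    also have "L2_set (\<lambda>n. cmod (\<psi> (n - 1))) {..<N} \<le> S N"
    proof (cases N)
      case (Suc k)
      have "(\<Sum>n<Suc k. (cmod (\<psi> (n - 1)))\<^sup>2) \<le> (\<Sum>n<Suc k. (cmod (\<psi> n))\<^sup>2)"
        by (subst sum.lessThan_Suc_shift) (simp add: \<psi>0)
      then show ?thesis unfolding S_def L2_set_def Suc by simp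
    qed (simp add: S_def)
    also have "L2_set (\<lambda>n. cmod (\<phi> n)) {..<N} \<le> ell2_norm \<phi>"
      unfolding L2_set_def ell2_norm_def
      by (intro real_sqrt_le_mono sum_le_suminf sum_phi) auto
    finally show ?thesis by (simp add: algebra_simps)
  qed
  have Ssq: "(\<Sum>n<N. (cmod (\<psi> n))\<^sup>2) = (S N)\<^sup>2" for N
    unfolding S_def L2_set_def by (simp add: sum_nonneg)
  have S0: "S N \<ge> 0" for N by (simp add: S_def)
  \<comment> \<open>The crude bound \<open>K\<close> on the boundary term serves only to get
    summability. Afterwards \<open>\<psi> N\<close> tends to 0, so \<open>K\<close> disappears from
    the final estimate.\<close>
  have "S N \<le> (ell2_norm \<phi> + K) / \<delta>" for N
    using main[of N] bd[of N] \<delta> by (simp add: pos_le_divide_eq mult.commute)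
  then have "(\<Sum>n<N. (cmod (\<psi> n))\<^sup>2) \<le> ((ell2_norm \<phi> + K) / \<delta>)\<^sup>2" for N
    unfolding Ssq by (intro power_mono S0)
  then have summ: "summable (\<lambda>n. (cmod (\<psi> n))\<^sup>2)"
    by (intro summableI_nonneg_bounded) auto
  then show "\<psi> \<in> ell2" by (simp add: ell2_def \<psi>0)
  have "(\<lambda>N. sqrt (\<Sum>n<N. (cmod (\<psi> n))\<^sup>2)) \<longlonglongrightarrow> ell2_norm \<psi>"
    unfolding ell2_norm_def by (intro tendsto_real_sqrt summable_LIMSEQ summ)
  then have 1: "(\<lambda>N. \<delta> * S N) \<longlonglongrightarrow> \<delta> * ell2_norm \<psi>"
    unfolding Ssq using S0 by (intro tendsto_mult_left) simp
  have "(\<lambda>N. sqrt ((cmod (\<psi> N))\<^sup>2)) \<longlonglongrightarrow> sqrt 0"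
    by (intro tendsto_real_sqrt summable_LIMSEQ_zero summ)
  then have 2: "(\<lambda>N. ell2_norm \<phi> + cmod (\<psi> N)) \<longlonglongrightarrow> ell2_norm \<phi> + 0"
    by (intro tendsto_add tendsto_const) simp
  show "\<delta> * ell2_norm \<psi> \<le> ell2_norm \<phi>"
    using LIMSEQ_le[OF 1 2] main by auto
qed

text \<open>The recurrence is a fixed point equation for \<open>G\<close>, a contraction in the sup
  norm with factor \<open>q = 2 / (2 + \<delta>)\<close>. Its iterates from 0 converge pointwise by
  a geometric series. A bounded solution suffices, since \<open>jacobi_bounded_solution_ell2\<close>
  upgrades it to \<open>ell2\<close>.\<close>

lemma jacobi_bounded_solution_exists:
  fixes D \<phi> :: "nat \<Rightarrow> complex"
  assumes \<delta>: "\<delta> > 0" and D: "\<And>n. n \<ge> 1 \<Longrightarrow> cmod (D n) \<ge> 2 + \<delta>"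
    and \<phi>: "\<And>n. cmod (\<phi> n) \<le> K"
  shows "\<exists>\<psi> C. \<psi> 0 = 0 \<and> (\<forall>n. cmod (\<psi> n) \<le> C) \<and>
    (\<forall>n\<ge>1. D n * \<psi> n = \<psi> (n + 1) + \<psi> (n - 1) - \<phi> n)"
proof -
  define G :: "(nat \<Rightarrow> complex) \<Rightarrow> nat \<Rightarrow> complex"
    where "G \<psi> n = (if n = 0 then 0 else (\<psi> (n + 1) + \<psi> (n - 1) - \<phi> n) / D n)" for \<psi> n
  define u where "u k = (G ^^ k) (\<lambda>_. 0)" for k
  define q where "q = 2 / (2 + \<delta>)"
  have q: "0 < q" "q < 1" using \<delta> by (auto simp: q_def)
  have K: "K \<ge> 0" using \<phi>[of 0] norm_ge_zero order_trans by blast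
  have uSuc: "u (Suc k) = G (u k)" for k by (simp add: u_def)
  have u0: "u k 0 = 0" for k by (cases k) (auto simp: u_def G_def)
  have step: "cmod (u (Suc k) n - u k n) \<le> K * q ^ k" for k n
  proof (induction k arbitrary: n)
    case 0
    show ?case
    proof (cases "n = 0")
      case False
      have "cmod (\<phi> n) / cmod (D n) \<le> K / 1"
        using D[of n] False \<delta> \<phi>[of n] K by (intro frac_le) auto
      then show ?thesis using False by (simp add: u_def G_def norm_divide)
    qed (use K in \<open>simp add: u0\<close>)
  next
    case (Suc k)
    show ?case
    proof (cases "n = 0")
      case False
      let ?d = "\<lambda>n. u (Suc k) n - u k n"
      have "u (Suc (Suc k)) n - u (Suc k) n = (?d (n+1) + ?d (n-1)) / D n"
        using False unfolding uSuc[of "Suc k"] uSuc[of k]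
        by (simp add: G_def diff_divide_distrib add_divide_distrib)
      also have "cmod \<dots> \<le> (2 * (K * q ^ k)) / (2 + \<delta>)"
        unfolding norm_divide
      proof (rule frac_le)
        show "cmod (?d (n+1) + ?d (n-1)) \<le> 2 * (K * q ^ k)"
          using Suc[of "n+1"] Suc[of "n-1"] norm_triangle_ineq[of "?d (n+1)" "?d (n-1)"] by linarith
      qed (use D[of n] False \<delta> K q in auto)
      finally show ?thesis by (simp add: q_def algebra_simps)
    qed (use K q in \<open>simp add: u0\<close>)
  qed
  have summ: "summable (\<lambda>k. K * q ^ k)" using q by (intro summable_mult summable_geometric) auto
  have tel: "(\<Sum>j<k. u (Suc j) n - u j n) = u k n" for k n
    by (subst sum_lessThan_telescope) (simp add: u_def)
  have cauchy: "summable (\<lambda>k. u (Suc k) n - u k n)" for n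
    by (rule summable_comparison_test'[OF summ]) (use step in auto)
  define \<psi> where "\<psi> n = (\<Sum>k. u (Suc k) n - u k n)" for n
  have lim: "(\<lambda>k. u k n) \<longlonglongrightarrow> \<psi> n" for n
    using summable_LIMSEQ[OF cauchy[of n]] unfolding tel \<psi>_def .
  have bound: "cmod (\<psi> n) \<le> (\<Sum>k. K * q ^ k)" for n
    unfolding \<psi>_def by (rule norm_suminf_le[OF step summ])
  show ?thesis
  proof (intro exI[of _ \<psi>] exI conjI allI impI, rule_tac [2] bound)
    show "\<psi> 0 = 0" by (simp add: \<psi>_def u0)
    fix n :: nat assume n: "n \<ge> 1"
    have "D n \<noteq> 0" using D[OF n] \<delta> by auto
    have "(\<lambda>k. u (Suc k) n) \<longlonglongrightarrow> (\<psi> (n+1) + \<psi> (n-1) - \<phi> n) / D n"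
      unfolding uSuc G_def using n \<open>D n \<noteq> 0\<close> by (auto intro!: tendsto_intros lim)
    moreover have "(\<lambda>k. u (Suc k) n) \<longlonglongrightarrow> \<psi> n" using lim by (rule LIMSEQ_Suc)
    ultimately have "\<psi> n = (\<psi> (n+1) + \<psi> (n-1) - \<phi> n) / D n" by (rule LIMSEQ_unique[rotated])
    then show "D n * \<psi> n = \<psi> (n + 1) + \<psi> (n - 1) - \<phi> n"
      using \<open>D n \<noteq> 0\<close> by (simp add: field_simps)
  qed
qed

lemma ell2_bounded: "\<phi> \<in> ell2 \<Longrightarrow> cmod (\<phi> n) \<le> ell2_norm \<phi>"
proof -
  assume "\<phi> \<in> ell2"
  then have "summable (\<lambda>n. (cmod (\<phi> n))\<^sup>2)" by (simp add: ell2_def)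
  then have "(\<Sum>k\<in>{n}. (cmod (\<phi> k))\<^sup>2) \<le> (\<Sum>k. (cmod (\<phi> k))\<^sup>2)" by (intro sum_le_suminf) auto
  then show ?thesis unfolding ell2_norm_def by (intro real_le_rsqrt) simp
qed

lemma ell2_linear_combination:
  assumes "\<phi> \<in> ell2" "\<psi> \<in> ell2" shows "(\<lambda>n. a * \<phi> n + b * \<psi> n) \<in> ell2"
proof -
  have le: "(cmod (a * \<phi> n + b * \<psi> n))\<^sup>2 \<le> 2 * (cmod a)\<^sup>2 * (cmod (\<phi> n))\<^sup>2 + 2 * (cmod b)\<^sup>2 * (cmod (\<psi> n))\<^sup>2" for n
  proof -
    have "(cmod (a * \<phi> n + b * \<psi> n))\<^sup>2 \<le> (cmod (a * \<phi> n) + cmod (b * \<psi> n))\<^sup>2"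
      by (intro power_mono norm_triangle_ineq) auto
    also have "\<dots> \<le> 2 * (cmod (a * \<phi> n))\<^sup>2 + 2 * (cmod (b * \<psi> n))\<^sup>2"
      using sum_squares_bound[of "cmod (a * \<phi> n)" "cmod (b * \<psi> n)"] by (simp add: power2_sum)
    finally show ?thesis by (simp add: norm_mult power_mult_distrib algebra_simps)
  qed
  have "summable (\<lambda>n. 2 * (cmod a)\<^sup>2 * (cmod (\<phi> n))\<^sup>2 + 2 * (cmod b)\<^sup>2 * (cmod (\<psi> n))\<^sup>2)"
    using assms unfolding ell2_def by (intro summable_add summable_mult) auto
  then have "summable (\<lambda>n. (cmod (a * \<phi> n + b * \<psi> n))\<^sup>2)"
    by (rule summable_comparison_test[rotated]) (use le in auto)
  then show ?thesis using assms by (simp add: ell2_def)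
qed

text \<open>For larger \<open>\<bar>E\<bar>\<close> the diagonal \<open>D\<close> satisfies the
  dominance condition with gap \<open>\<delta>\<close>, so the two preceding results on the
  recurrence produce a two-sided inverse of norm at most \<open>1 / \<delta>\<close>.\<close>

lemma ell2_spectrum_schroedinger_bound:
  fixes T :: "real \<times> 'y \<Rightarrow> real \<times> 'y"
  assumes B: "\<And>x. \<bar>v x\<bar> \<le> B" and lam: "lam \<ge> 0"
    and E: "complex_of_real E \<in> ell2_spectrum (schroedinger T v lam p)"
  shows "\<bar>E\<bar> \<le> 2 + lam * B"
proof (rule ccontr)
  define \<delta> where "\<delta> = \<bar>E\<bar> - 2 - lam * B"
  assume "\<not> \<bar>E\<bar> \<le> 2 + lam * B"
  then have \<delta>: "\<delta> > 0" by (simp add: \<delta>_def)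
  let ?A = "schroedinger T v lam p"
  let ?z = "complex_of_real E"
  define D where "D n = ?z - complex_of_real (lam * v (fst ((T ^^ n) p)))" for n
  have D: "cmod (D n) \<ge> 2 + \<delta>" for n
  proof -
    have "\<bar>lam * v (fst ((T ^^ n) p))\<bar> \<le> lam * B"
      using B lam by (simp add: abs_mult mult_left_mono)
    then have "\<bar>E - lam * v (fst ((T ^^ n) p))\<bar> \<ge> 2 + \<delta>"
      unfolding \<delta>_def by linarith
    then show ?thesis unfolding D_def of_real_diff[symmetric] norm_of_real .
  qed
  \<comment> \<open>At \<open>n = 0\<close> both sides vanish, so the operator equation is exactly
    the recurrence for \<open>n \<ge> 1\<close>.\<close>
  have iff: "((\<lambda>n. ?A \<psi> n - ?z * \<psi> n) = \<phi>) \<longleftrightarrow>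
     (\<forall>n\<ge>1. D n * \<psi> n = \<psi> (n + 1) + \<psi> (n - 1) - \<phi> n)" if "\<psi> 0 = 0" "\<phi> 0 = 0" for \<psi> \<phi>
    using that by (auto simp: fun_eq_iff schroedinger_def D_def algebra_simps Suc_le_eq)
  have "\<exists>R. \<forall>\<phi>\<in>ell2. R \<phi> \<in> ell2 \<and> ell2_norm (R \<phi>) \<le> 1 / \<delta> * ell2_norm \<phi> \<and>
       (\<lambda>n. ?A (R \<phi>) n - ?z * R \<phi> n) = \<phi>"
  proof (rule bchoice, rule ballI)
    fix \<phi> assume \<phi>: "\<phi> \<in> ell2"
    obtain \<psi> C where \<psi>: "\<psi> 0 = 0" "\<And>n. cmod (\<psi> n) \<le> C"
      "\<And>n. n \<ge> 1 \<Longrightarrow> D n * \<psi> n = \<psi> (n + 1) + \<psi> (n - 1) - \<phi> n"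
      using jacobi_bounded_solution_exists[of \<delta> D \<phi>, OF \<delta> D ell2_bounded[OF \<phi>]] by blast
    note * = jacobi_bounded_solution_ell2[OF \<delta> D \<psi>(1,2) \<phi> \<psi>(3)]
    have "(\<lambda>n. ?A \<psi> n - ?z * \<psi> n) = \<phi>"
      using \<phi> \<psi>(3) by (subst iff[of \<psi> \<phi>, OF \<psi>(1)]) (auto simp: ell2_def)
    with * show "\<exists>\<psi>. \<psi> \<in> ell2 \<and> ell2_norm \<psi> \<le> 1 / \<delta> * ell2_norm \<phi> \<and> (\<lambda>n. ?A \<psi> n - ?z * \<psi> n) = \<phi>"
      using \<delta> by (intro exI[of _ \<psi>]) (auto simp: field_simps)
  qed
  then obtain R where R: "\<And>\<phi>. \<phi> \<in> ell2 \<Longrightarrow> R \<phi> \<in> ell2"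
    "\<And>\<phi>. \<phi> \<in> ell2 \<Longrightarrow> ell2_norm (R \<phi>) \<le> 1 / \<delta> * ell2_norm \<phi>"
    "\<And>\<phi>. \<phi> \<in> ell2 \<Longrightarrow> (\<lambda>n. ?A (R \<phi>) n - ?z * R \<phi> n) = \<phi>" by metis
  have left: "R (\<lambda>n. ?A \<phi> n - ?z * \<phi> n) = \<phi>" if \<phi>: "\<phi> \<in> ell2" for \<phi>
  proof -
    define \<eta> where "\<eta> = (\<lambda>n. ?A \<phi> n - ?z * \<phi> n)"
    have \<phi>0: "\<phi> 0 = 0" using \<phi> by (simp add: ell2_def)
    have \<eta>: "\<eta> \<in> ell2"
    proof -
      have s: "summable (\<lambda>n. (cmod (\<phi> n))\<^sup>2)" using \<phi> by (simp add: ell2_def)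
      \<comment> \<open>The coordinate 0 is reset because the plain left shift can violate the
        boundary condition built into \<open>ell2\<close>.\<close>
      have 1: "(\<lambda>n. if n = 0 then 0 else \<phi> (n + 1)) \<in> ell2"
        unfolding ell2_def using s
        by (simp, subst summable_Suc_iff[symmetric], simp, subst (asm) summable_iff_shift[where k=2, symmetric]) simp
      have 2: "(\<lambda>n. \<phi> (n - 1)) \<in> ell2"
        unfolding ell2_def using s \<phi>0 by (simp, subst summable_Suc_iff[symmetric]) simp
      have 3: "(\<lambda>n. D n * \<phi> n) \<in> ell2"
      proof -
        have "(cmod (D n * \<phi> n))\<^sup>2 \<le> (\<bar>E\<bar> + lam * B)\<^sup>2 * (cmod (\<phi> n))\<^sup>2" for n
        proof -
          have "\<bar>lam * v (fst ((T ^^ n) p))\<bar> \<le> lam * B"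
            using B lam by (simp add: abs_mult mult_left_mono)
          then have "\<bar>E - lam * v (fst ((T ^^ n) p))\<bar> \<le> \<bar>E\<bar> + lam * B" by linarith
          then have "cmod (D n) \<le> \<bar>E\<bar> + lam * B"
            unfolding D_def of_real_diff[symmetric] norm_of_real .
          then show ?thesis unfolding norm_mult power_mult_distrib by (intro mult_right_mono power_mono) auto
        qed
        then have le: "norm ((cmod (D n * \<phi> n))\<^sup>2) \<le> (\<bar>E\<bar> + lam * B)\<^sup>2 * (cmod (\<phi> n))\<^sup>2" for n
          by (simp only: real_norm_def abs_power2)
        have "summable (\<lambda>n. (cmod (D n * \<phi> n))\<^sup>2)"
          using summable_comparison_test'[OF summable_mult[OF s], of 0, OF le] .
        then show ?thesis by (simp add: ell2_def \<phi>0)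
      qed
      have "\<eta> = (\<lambda>n. 1 * (1 * (if n = 0 then 0 else \<phi> (n + 1)) + 1 * \<phi> (n - 1)) + (-1) * (D n * \<phi> n))"
        unfolding \<eta>_def by (auto simp: schroedinger_def D_def \<phi>0 fun_eq_iff algebra_simps)
      also have "\<dots> \<in> ell2" by (intro ell2_linear_combination 1 2 3)
      finally show ?thesis .
    qed
    have R0: "R \<eta> 0 = 0" and \<eta>0: "\<eta> 0 = 0" using R(1)[OF \<eta>] \<eta> by (auto simp: ell2_def)
    have e1: "\<forall>n\<ge>1. D n * R \<eta> n = R \<eta> (n + 1) + R \<eta> (n - 1) - \<eta> n"
      using R(3)[OF \<eta>] iff[of "R \<eta>" \<eta>, OF R0 \<eta>0] by blast
    have e2: "\<forall>n\<ge>1. D n * \<phi> n = \<phi> (n + 1) + \<phi> (n - 1) - \<eta> n"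
      using iff[of \<phi> \<eta>, OF \<phi>0 \<eta>0] \<eta>_def by blast
    \<comment> \<open>Uniqueness: \<open>w\<close> is the difference of two solutions with the same
      source \<open>\<eta>\<close>, and the a priori estimate with zero source forces it to
      vanish.\<close>
    define w where "w = (\<lambda>n. 1 * R \<eta> n + (-1) * \<phi> n)"
    have w: "w \<in> ell2" unfolding w_def by (intro ell2_linear_combination R(1) \<eta> \<phi>)
    have z: "(\<lambda>n. 0) \<in> ell2" by (simp add: ell2_def)
    have "\<delta> * ell2_norm w \<le> ell2_norm (\<lambda>n. 0)"
    proof (rule jacobi_bounded_solution_ell2(2)[OF \<delta> D _ ell2_bounded[OF w] z])
      show "w 0 = 0" using w by (simp add: ell2_def)
      show "D n * w n = w (n + 1) + w (n - 1) - 0" if "n \<ge> 1" for n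
      proof -
        have "D n * R \<eta> n = R \<eta> (n + 1) + R \<eta> (n - 1) - \<eta> n"
          "D n * \<phi> n = \<phi> (n + 1) + \<phi> (n - 1) - \<eta> n" using e1 e2 that by blast+
        moreover have "D n * w n = D n * R \<eta> n - D n * \<phi> n" by (simp add: w_def right_diff_distrib)
        ultimately show ?thesis by (simp add: w_def)
      qed
    qed
    then have "ell2_norm w \<le> 0" using \<delta> by (simp add: ell2_norm_def mult_le_0_iff)
    then have "w n = 0" for n using ell2_bounded[OF w, of n] norm_ge_zero[of "w n"]
      by (metis norm_le_zero_iff order_trans)
    then show ?thesis by (auto simp: w_def \<eta>_def[symmetric] fun_eq_iff)
  qed
  have "complex_of_real E \<notin> ell2_spectrum ?A"
    unfolding ell2_spectrum_def using R left by (auto intro!: exI[of _ R] exI[of _ "1 / \<delta>"])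
  with E show False by simp
qed

section \<open>Analytic extension to a strip\<close>

text \<open>Identity theorem: since \<open>S\<close> is open, the real points of \<open>S\<close>
  accumulate at \<open>x\<close>.\<close>

lemma holomorphic_eq_on_reals:
  fixes f g :: "complex \<Rightarrow> complex"
  assumes "f holomorphic_on S" "g holomorphic_on S" "open S" "connected S"
    and x: "complex_of_real x \<in> S"
    and eq: "\<And>t. complex_of_real t \<in> S \<Longrightarrow> f (of_real t) = g (of_real t)"
    and z: "z \<in> S"
  shows "f z = g z"
proof -
  obtain d where d: "d > 0" "ball (complex_of_real x) d \<subseteq> S"
    using \<open>open S\<close> x open_contains_ball by blast
  have lim: "complex_of_real x islimpt (S \<inter> \<real>)"
    unfolding islimpt_approachable
  proof (intro allI impI)
    fix e :: real assume e: "e > 0"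
    define t where "t = x + min d e / 2"
    have "dist (complex_of_real t) (of_real x) = min d e / 2"
      unfolding dist_of_real using d e by (simp add: dist_real_def t_def)
    then have "dist (complex_of_real t) (of_real x) < e" "dist (of_real x) (complex_of_real t) < d"
      using d e by (simp_all del: dist_of_real add: dist_commute[of "of_real x"])
    moreover have "complex_of_real t \<noteq> of_real x" using d e by (simp add: t_def)
    ultimately show "\<exists>x'\<in>S \<inter> \<real>. x' \<noteq> complex_of_real x \<and> dist x' (complex_of_real x) < e"
      using d by (intro bexI[of _ "of_real t"]) (auto simp: subset_iff)
  qed
  have "f z - g z = 0"
  proof (rule analytic_continuation[OF _ \<open>open S\<close> \<open>connected S\<close> _ x lim _ z])
    show "(\<lambda>z. f z - g z) holomorphic_on S" by (intro holomorphic_on_diff assms)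
  qed (use eq in \<open>auto elim!: Reals_cases\<close>)
  then show ?thesis by simp
qed

section \<open>Periodic functions and horizontal strips\<close>

lemma periodic_of_int:
  fixes h :: "real \<Rightarrow> 'a"
  assumes "\<And>x. h (x + 1) = h x"
  shows "h (x + of_int k) = h x"
proof (induction k rule: int_induct[where k = 0])
  case (step1 i)
  then show ?case using assms by (metis add.assoc of_int_1 of_int_add)
next
  case (step2 i)
  have "x + of_int (i - 1) + 1 = x + of_int i" by simp
  then show ?case using step2 assms by metis
qed simp

lemma periodic_frac:
  fixes h :: "real \<Rightarrow> 'a"
  assumes "\<And>x. h (x + 1) = h x"
  shows "h (frac x) = h x"
  using periodic_of_int[of h x "- \<lfloor>x\<rfloor>", OF assms] by (simp add: frac_def)

lemma open_strip: "open {z. \<bar>Im z\<bar> < R}"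
  by (intro open_Collect_less continuous_intros)

lemma connected_strip: "connected {z. \<bar>Im z\<bar> < R}"
proof -
  have "{z. \<bar>Im z\<bar> < R} = {z. Im z < R} \<inter> {z. Im z > - R}" by auto
  then show ?thesis by (simp add: convex_connected convex_Int convex_halfspace_Im_lt convex_halfspace_Im_gt)
qed

text \<open>The real power series also converges in the complex disc of the same radius: convergence
  at the real point \<open>x0 + s\<close> implies convergence wherever \<open>z\<close> is closer to
  \<open>x0\<close> than \<open>s\<close>.\<close>

lemma real_analytic_local_extension:
  assumes "real_analytic v"
  shows "\<exists>r>0. \<exists>F. F holomorphic_on ball (complex_of_real x0) r \<and>
     (\<forall>x. \<bar>x - x0\<bar> < r \<longrightarrow> F (of_real x) = of_real (v x))"
proof -
  obtain r a where r: "r > 0" and sums: "\<And>x. \<bar>x - x0\<bar> < r \<Longrightarrow> (\<lambda>n. a n * (x - x0) ^ n) sums v x"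
    using assms unfolding real_analytic_def by blast
  define F where "F z = (\<Sum>n. complex_of_real (a n) * (z - of_real x0) ^ n)" for z
  have "(\<lambda>n. complex_of_real (a n) * (z - of_real x0) ^ n) sums F z" if "z \<in> ball (of_real x0) r" for z
  proof -
    have "cmod (z - of_real x0) < r" using that by (simp add: dist_norm norm_minus_commute)
    then obtain s where s: "cmod (z - of_real x0) < s" "s < r" using dense by blast
    then have "s > 0" by (meson norm_ge_zero order_le_less_trans)
    have "(\<lambda>n. a n * (x0 + s - x0) ^ n) sums v (x0 + s)" using s \<open>s > 0\<close> by (intro sums) auto
    then have "summable (\<lambda>n. a n * s ^ n)" by (auto dest: sums_summable)
    then have "summable (\<lambda>n. complex_of_real (a n * s ^ n))" by (rule summable_of_real)
    then have "summable (\<lambda>n. complex_of_real (a n) * of_real s ^ n)" by simp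
    then have "summable (\<lambda>n. complex_of_real (a n) * (z - of_real x0) ^ n)"
      by (rule powser_inside) (use s \<open>s > 0\<close> in auto)
    then show ?thesis unfolding F_def by (rule summable_sums)
  qed
  then have "F holomorphic_on ball (of_real x0) r" by (rule power_series_holomorphic)
  moreover have "F (of_real x) = of_real (v x)" if "\<bar>x - x0\<bar> < r" for x
  proof -
    have "(\<lambda>n. complex_of_real (a n * (x - x0) ^ n)) sums of_real (v x)"
      by (intro sums_of_real sums that)
    then show ?thesis unfolding F_def by (simp add: sums_unique[symmetric])
  qed
  ultimately show ?thesis using r by blast
qed

text \<open>A Lebesgue number \<open>e\<close> for the discs over \<open>[0, 1]\<close>, together
  with integer translation, yields extensions on discs of one common radius about all real points.
  These discs cover the strip of half-width \<open>e\<close>, and the extensions agree on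
  overlaps.\<close>

lemma real_analytic_strip_extension:
  assumes an: "real_analytic v" and per: "periodic1 v"
  obtains R V where "R > 0" "V holomorphic_on {z. \<bar>Im z\<bar> < R}"
    "\<And>x. V (complex_of_real x) = of_real (v x)" "\<And>z. \<bar>Im z\<bar> < R \<Longrightarrow> V (z + 1) = V z"
proof -
  obtain r F where r: "\<And>x0. r x0 > 0"
    and F: "\<And>x0. F x0 holomorphic_on ball (complex_of_real x0) (r x0)"
    and Fv: "\<And>x0 x. \<bar>x - x0\<bar> < r x0 \<Longrightarrow> F x0 (of_real x) = of_real (v x)"
    using real_analytic_local_extension[OF an] by metis
  have "compact (complex_of_real ` {0..1})"
    by (intro compact_continuous_image continuous_intros) auto
  then obtain e where e: "e > 0" and cover: "\<And>t. t \<in> {0..1} \<Longrightarrow>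
      \<exists>x0. ball (complex_of_real t) e \<subseteq> ball (of_real x0) (r x0)"
  proof (rule Heine_Borel_lemma[where \<G> = "range (\<lambda>x0. ball (complex_of_real x0) (r x0))"])
    show "complex_of_real ` {0..1} \<subseteq> (\<Union>x0. ball (complex_of_real x0) (r x0))"
      using r centre_in_ball by blast
  qed (auto intro: that)
  have per_int: "v (x + of_int k) = v x" for x k
    using per by (intro periodic_of_int) (simp add: periodic1_def)
  have "\<exists>G. G holomorphic_on ball (complex_of_real t) e \<and>
      (\<forall>x. \<bar>x - t\<bar> < e \<longrightarrow> G (of_real x) = of_real (v x))" for t
  proof -
    have "frac t \<in> {0..1}" using frac_lt_1[of t] by auto
    then obtain x0 where x0: "ball (complex_of_real (frac t)) e \<subseteq> ball (of_real x0) (r x0)"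
      using cover by blast
    \<comment> \<open>An extension near \<open>frac t\<close>, carried to \<open>t\<close> by an
      integer translation that preserves \<open>v\<close>.\<close>
    define G where "G z = F x0 (z - of_int \<lfloor>t\<rfloor>)" for z
    have t: "complex_of_real t = of_real (frac t) + of_int \<lfloor>t\<rfloor>" by (simp add: frac_def)
    have "G holomorphic_on ball (complex_of_real t) e"
      unfolding G_def
    proof (rule holomorphic_on_compose_gen[OF _ F[of x0], unfolded o_def])
      show "(\<lambda>z. z - of_int \<lfloor>t\<rfloor>) ` ball (complex_of_real t) e \<subseteq> ball (of_real x0) (r x0)"
      proof (intro image_subsetI subsetD[OF x0])
        fix z assume "z \<in> ball (complex_of_real t) e"
        then show "z - of_int \<lfloor>t\<rfloor> \<in> ball (complex_of_real (frac t)) e"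
          unfolding t by (simp add: dist_norm algebra_simps)
      qed
    qed (intro holomorphic_intros)
    moreover have "G (of_real x) = of_real (v x)" if "\<bar>x - t\<bar> < e" for x
    proof -
      let ?x = "x - of_int \<lfloor>t\<rfloor>"
      have "\<bar>?x - frac t\<bar> < e" using that by (simp add: frac_def)
      then have "complex_of_real ?x \<in> ball (complex_of_real (frac t)) e"
        by (simp only: mem_ball dist_of_real) (simp add: dist_real_def abs_minus_commute)
      then have "complex_of_real ?x \<in> ball (of_real x0) (r x0)" using x0 by blast
      then have "\<bar>?x - x0\<bar> < r x0"
        by (simp only: mem_ball dist_of_real) (simp add: dist_real_def abs_minus_commute)
      then have "F x0 (of_real ?x) = of_real (v ?x)" by (rule Fv)
      also have "v ?x = v x" using per_int[of x "- \<lfloor>t\<rfloor>"] by simp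
      finally show ?thesis by (simp add: G_def)
    qed
    ultimately show ?thesis by blast
  qed
  then obtain G where G: "\<And>t. G t holomorphic_on ball (complex_of_real t) e"
    and Gv: "\<And>t x. \<bar>x - t\<bar> < e \<Longrightarrow> G t (of_real x) = of_real (v x)" by metis
  have in_ball: "z \<in> ball (complex_of_real (Re z)) e" if "\<bar>Im z\<bar> < e" for z
    using that by (simp add: dist_norm cmod_def)
  \<comment> \<open>The overlap is convex and, because both centres are real, contains
    \<open>Re z\<close> along with \<open>z\<close>. Hence the identity theorem applies from the
    real axis.\<close>
  have glue: "G t z = G s z" if "z \<in> ball (complex_of_real t) e" "z \<in> ball (complex_of_real s) e" for t s z
  proof (rule holomorphic_eq_on_reals[where f = "G t" and g = "G s" and S = "ball (complex_of_real t) e \<inter> ball (complex_of_real s) e"])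
    have "complex_of_real (Re z) \<in> ball (complex_of_real t) e" if "z \<in> ball (complex_of_real t) e" for t
    proof -
      have "\<bar>t - Re z\<bar> \<le> cmod (complex_of_real t - z)" using abs_Re_le_cmod[of "complex_of_real t - z"] by simp
      then show ?thesis using that by (simp only: mem_ball dist_of_real) (simp add: dist_norm)
    qed
    then show "complex_of_real (Re z) \<in> ball (complex_of_real t) e \<inter> ball (complex_of_real s) e"
      using that by auto
    show "connected (ball (complex_of_real t) e \<inter> ball (complex_of_real s) e)"
      by (intro convex_connected convex_Int convex_ball)
    fix x assume "complex_of_real x \<in> ball (complex_of_real t) e \<inter> ball (complex_of_real s) e"
    then have "\<bar>x - t\<bar> < e" "\<bar>x - s\<bar> < e"
      by (simp_all only: mem_ball Int_iff dist_of_real) (simp_all add: dist_real_def abs_minus_commute)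
    then show "G t (of_real x) = G s (of_real x)" by (simp add: Gv)
  qed (use that G holomorphic_on_subset in \<open>auto intro!: holomorphic_on_subset[OF G]\<close>)
  define V where "V z = G (Re z) z" for z
  let ?S = "{z. \<bar>Im z\<bar> < e}"
  have V: "V holomorphic_on ?S"
    unfolding holomorphic_on_def
  proof
    fix z assume z: "z \<in> ?S"
    have "V holomorphic_on ball (complex_of_real (Re z)) e"
    proof (rule holomorphic_transform[OF G[of "Re z"]])
      fix w assume w: "w \<in> ball (complex_of_real (Re z)) e"
      have "\<bar>Im w\<bar> \<le> cmod (complex_of_real (Re z) - w)"
        using abs_Im_le_cmod[of "complex_of_real (Re z) - w"] by simp
      then have "\<bar>Im w\<bar> < e" using w by (simp add: dist_norm)
      then show "G (Re z) w = V w" unfolding V_def by (intro glue w in_ball)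
    qed
    then have "V field_differentiable at z"
      using in_ball z by (intro holomorphic_on_imp_differentiable_at) auto
    then show "V field_differentiable at z within ?S" by (rule field_differentiable_at_within)
  qed
  have Vv: "V (complex_of_real x) = of_real (v x)" for x
    unfolding V_def using e by (simp add: Gv)
  have "V (z + 1) = V z" if "\<bar>Im z\<bar> < e" for z
  proof (rule holomorphic_eq_on_reals[where f = "\<lambda>z. V (z + 1)" and g = V and S = ?S and x = 0])
    show "(\<lambda>z. V (z + 1)) holomorphic_on ?S"
      by (rule holomorphic_on_compose_gen[OF _ V, unfolded o_def]) (auto intro!: holomorphic_intros)
    fix t :: real
    have "V (of_real t + 1) = of_real (v (t + 1))" using Vv[of "t + 1"] by simp
    then show "V (of_real t + 1) = V (of_real t)" using per by (simp add: Vv periodic1_def)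
  qed (use that V e in \<open>auto intro: open_strip connected_strip\<close>)
  then show ?thesis using that[of e V] e V Vv by blast
qed

lemma continuous_on_real_restriction:
  fixes V :: "complex \<Rightarrow> complex" and v :: "real \<Rightarrow> real"
  assumes hol: "V holomorphic_on {z. \<bar>Im z\<bar> < R}" and R: "R > 0"
    and Vv: "\<And>x. V (complex_of_real x) = of_real (v x)"
  shows "continuous_on UNIV v"
proof -
  have "continuous_on UNIV (\<lambda>x. Re (V (complex_of_real x)))"
    using R by (intro continuous_intros continuous_on_compose2[OF holomorphic_on_imp_continuous_on[OF hol]]) auto
  then show ?thesis by (simp add: Vv)
qed

lemma real_analytic_continuous_on:
  assumes "real_analytic v" and "periodic1 v" shows "continuous_on UNIV v"
proof (rule real_analytic_strip_extension[OF assms])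
  fix R V assume "R > 0" "V holomorphic_on {z. \<bar>Im z\<bar> < R}"
    "\<And>x. V (complex_of_real x) = of_real (v x)"
  then show ?thesis by (intro continuous_on_real_restriction[of V R])
qed

section \<open>The maximum principle on periodic strips\<close>

lemma periodic_norm_of_int:
  fixes F :: "complex \<Rightarrow> complex"
  assumes per: "\<And>z. \<bar>Im z\<bar> < R \<Longrightarrow> cmod (F (z + of_real p)) = cmod (F z)" and "\<bar>Im z\<bar> < R"
  shows "cmod (F (z + of_real (of_int k * p))) = cmod (F z)"
proof (induction k rule: int_induct[where k = 0])
  case (step1 i)
  let ?w = "z + of_real (of_int i * p)"
  have eq: "z + of_real (of_int (i + 1) * p) = ?w + of_real p"
    by (simp add: algebra_simps)
  have "\<bar>Im ?w\<bar> < R" using assms(2) by simp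
  from per[OF this] show ?case unfolding eq using step1.IH by (rule trans)
next
  case (step2 i)
  let ?w = "z + of_real (of_int (i - 1) * p)"
  have eq: "z + of_real (of_int i * p) = ?w + of_real p"
    by (simp add: algebra_simps)
  have "\<bar>Im ?w\<bar> < R" using assms(2) by simp
  from per[OF this] show ?case using step2.IH unfolding eq by simp
qed simp

text \<open>Periodicity of the modulus reduces the closed strip
  \<open>0 \<le> Im z \<le> \<rho>\<close> to a compact rectangle, so the modulus attains a maximum.
  The hypothesis \<open>less\<close> excludes the upper line. Only the modulus is taken periodic
  because the exponential factor used later is periodic only up to a phase.\<close>

lemma strip_maximum_on_real_line:
  fixes F :: "complex \<Rightarrow> complex"
  assumes hol: "F holomorphic_on {z. \<bar>Im z\<bar> < R}" and p: "p > 0"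
    and per: "\<And>z. \<bar>Im z\<bar> < R \<Longrightarrow> cmod (F (z + of_real p)) = cmod (F z)"
    and t: "0 < t" "t < \<rho>" "\<rho> < R"
    and less: "\<And>x. cmod (F (Complex x \<rho>)) < cmod (F (Complex 0 t))"
  shows "\<exists>x\<in>{0..p}. cmod (F (of_real x)) \<ge> cmod (F (Complex 0 t))"
proof -
  define Q where "Q = cbox 0 (Complex p \<rho>)"
  have Q: "z \<in> Q \<longleftrightarrow> 0 \<le> Re z \<and> Re z \<le> p \<and> 0 \<le> Im z \<and> Im z \<le> \<rho>" for z
    by (auto simp: Q_def in_cbox_complex_iff)
  have "Q \<subseteq> {z. \<bar>Im z\<bar> < R}" using t by (auto simp: Q)
  then have "continuous_on Q (\<lambda>z. cmod (F z))"
    using holomorphic_on_imp_continuous_on[OF hol] continuous_on_subset by (intro continuous_on_norm) blast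
  moreover have "compact Q" "0 \<in> Q" using p t by (auto simp: Q) (simp add: Q_def)
  ultimately obtain w where w: "w \<in> Q" and wmax: "\<And>z. z \<in> Q \<Longrightarrow> cmod (F z) \<le> cmod (F w)"
    using continuous_attains_sup[of Q "\<lambda>z. cmod (F z)"] by blast
  have max: "cmod (F z) \<le> cmod (F w)" if z: "0 \<le> Im z" "Im z \<le> \<rho>" for z
  proof -
    define k where "k = \<lfloor>Re z / p\<rfloor>"
    have "of_int k \<le> Re z / p" "Re z / p < of_int k + 1" by (auto simp: k_def)
    then have k: "of_int k * p \<le> Re z" "Re z < (of_int k + 1) * p"
      using p by (auto simp: le_divide_eq divide_less_eq)
    have "cmod (F z) = cmod (F (z - of_real (of_int k * p)))"
      using periodic_norm_of_int[of R F p "z - of_real (of_int k * p)" k, OF per] z t by simp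
    also have "\<dots> \<le> cmod (F w)"
      using k z by (intro wmax) (auto simp: Q algebra_simps)
    finally show ?thesis .
  qed
  have t_le: "cmod (F (Complex 0 t)) \<le> cmod (F w)" using t by (intro max) auto
  show ?thesis
  proof (cases "Im w = 0")
    case True
    then have "w = of_real (Re w)" by (simp add: complex_eq_iff)
    then show ?thesis using t_le w by (intro bexI[of _ "Re w"]) (auto simp: Q)
  next
    case False
    have "Im w \<noteq> \<rho>" using less[of "Re w"] t_le by (metis complex_surj not_less)
    then have wS: "w \<in> {z. 0 < Im z} \<inter> {z. Im z < \<rho>}" using False w by (auto simp: Q)
    let ?S = "{z. 0 < Im z} \<inter> {z. Im z < \<rho>}"
    have S: "open ?S" "connected ?S"
      by (auto simp: open_halfspace_Im_lt open_halfspace_Im_gt convex_connected convex_Int convex_halfspace_Im_lt convex_halfspace_Im_gt)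
    have sub: "?S \<subseteq> {z. \<bar>Im z\<bar> < R}" using t by auto
    \<comment> \<open>An interior maximum makes \<open>F\<close> constant on the open strip and
      then, by the identity theorem, up to the line \<open>Im z = \<rho>\<close>, contradicting
      \<open>less\<close>.\<close>
    have "F constant_on ?S"
      by (rule maximum_modulus_principle[OF holomorphic_on_subset[OF hol sub] S S(1) order_refl wS])
         (use max in auto)
    then obtain c where c: "\<And>z. z \<in> ?S \<Longrightarrow> F z = c" unfolding constant_on_def by blast
    have "F z = c" if "\<bar>Im z\<bar> < R" for z
      by (rule analytic_continuation_open[OF S(1) open_strip _ connected_strip sub hol, where g = "\<lambda>_. c"])
         (use c that wS in auto)
    then have "F (Complex 0 \<rho>) = F (Complex 0 t)" using t by simp
    then show ?thesis using less[of 0] by simp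
  qed
qed

text \<open>The product of \<open>N\<close> translates has period \<open>1 / N\<close>, which places
  the good real point in \<open>[0, 1 / N]\<close>; the logarithm of the product is the desired sum.
  Nonvanishing is recorded so that each logarithm can later be compared with a matrix norm.\<close>

lemma shifted_log_sum_lower_bound:
  fixes P :: "complex \<Rightarrow> complex" and N :: nat
  assumes hol: "P holomorphic_on {z. \<bar>Im z\<bar> < R}"
    and per: "\<And>z. \<bar>Im z\<bar> < R \<Longrightarrow> P (z + 1) = P z"
    and t: "0 < t" "t < \<rho>" "\<rho> < R" and N: "N > 0"
    and lower: "\<And>x. cmod (P (Complex x t)) \<ge> a" and a: "a > 0"
    and upper: "\<And>x. cmod (P (Complex x \<rho>)) \<le> U"
    and less: "U * exp (- b * \<rho>) < a * exp (- b * t)"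
  shows "\<exists>x\<in>{0..1 / real N}. (\<forall>k<N. P (of_real (x + real k / real N)) \<noteq> 0) \<and>
     (\<Sum>k<N. ln (cmod (P (of_real (x + real k / real N))))) \<ge> real N * (ln a - b * t)"
proof -
  define sh where "sh k = complex_of_real (real k / real N)" for k
  define W where "W z = (\<Prod>k<N. P (z + sh k))" for z
  define F where "F z = W z * exp (\<i> * of_real (b * N) * z)" for z
  have Im_sh: "Im (z + sh k) = Im z" for z k by (simp add: sh_def)
  have Complex_sh: "Complex x y + sh k = Complex (x + real k / real N) y" for x y k
    by (simp add: sh_def complex_eq_iff)
  have holF: "F holomorphic_on {z. \<bar>Im z\<bar> < R}"
  proof -
    have "(\<lambda>z. P (z + sh k)) holomorphic_on {z. \<bar>Im z\<bar> < R}" for k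
      by (rule holomorphic_on_compose_gen[OF _ hol, unfolded o_def])
         (auto intro!: holomorphic_intros simp: Im_sh simp del: plus_complex.sel)
    then show ?thesis unfolding F_def W_def by (intro holomorphic_intros)
  qed
  \<comment> \<open>The exponential has constant modulus on each horizontal line and modulus 1 on
    the real axis, where the conclusion is read off.\<close>
  have normF: "cmod (F z) = cmod (W z) * exp (- b * Im z * N)" for z
    by (simp add: F_def norm_mult mult_ac)
  have perW: "W (z + of_real (1 / N)) = W z" if z: "\<bar>Im z\<bar> < R" for z
  proof -
    have "W (z + of_real (1 / N)) = (\<Prod>k<N. P (z + sh (Suc k)))"
      unfolding W_def sh_def by (intro prod.cong refl arg_cong[where f = P]) (simp add: add_divide_distrib)
    also have "\<dots> = W z"
    proof -
      have "P (z + sh 0) * (\<Prod>k<N. P (z + sh (Suc k))) = (\<Prod>k<Suc N. P (z + sh k))"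
        by (subst prod.lessThan_Suc_shift) simp
      also have "\<dots> = W z * P (z + 1)" using N by (simp add: W_def sh_def)
      also have "P (z + 1) = P (z + sh 0)" using per[OF z] by (simp add: sh_def)
      finally have *: "P (z + sh 0) * (\<Prod>k<N. P (z + sh (Suc k))) = P (z + sh 0) * W z" by simp
      \<comment> \<open>The factor at \<open>sh 0\<close> is cancelled if it is nonzero. Otherwise
        both products vanish, the shifted one through its last factor \<open>k = N - 1\<close>,
        where the translation is by 1.\<close>
      show ?thesis
      proof (cases "P (z + sh 0) = 0")
        case True
        then have "W z = 0" unfolding W_def using N by (intro prod_zero) auto
        moreover have "sh (Suc (N - 1)) = 1" using N by (simp add: sh_def)
        then have "P (z + sh (Suc (N - 1))) = 0" using per[OF z] True by (simp add: sh_def)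
        then have "(\<Prod>k<N. P (z + sh (Suc k))) = 0" using N by (intro prod_zero bexI[of _ "N - 1"]) auto
        ultimately show ?thesis by simp
      qed (use * in simp)
    qed
    finally show ?thesis .
  qed
  have up: "cmod (F (Complex x \<rho>)) \<le> (U * exp (- b * \<rho>)) ^ N" for x
  proof -
    have "cmod (W (Complex x \<rho>)) \<le> (\<Prod>k<N. U)"
      unfolding W_def prod_norm[symmetric] Complex_sh
      using upper by (intro prod_mono) auto
    then show ?thesis
      by (simp add: normF power_mult_distrib exp_of_nat_mult[symmetric] mult_ac)
  qed
  have lo: "(a * exp (- b * t)) ^ N \<le> cmod (F (Complex x t))" for x
  proof -
    have "(\<Prod>k<N. a) \<le> cmod (W (Complex x t))"
      unfolding W_def prod_norm[symmetric] Complex_sh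
      using lower a by (intro prod_mono) auto
    then show ?thesis
      by (simp add: normF power_mult_distrib exp_of_nat_mult[symmetric] mult_ac)
  qed
  have "U \<ge> 0" using upper[of 0] norm_ge_zero order_trans by blast
  then have "(U * exp (- b * \<rho>)) ^ N < (a * exp (- b * t)) ^ N"
    using less N by (intro power_strict_mono) auto
  then have "\<exists>x\<in>{0..1 / real N}. cmod (F (of_real x)) \<ge> cmod (F (Complex 0 t))"
    using up lo[of 0] N by (intro strip_maximum_on_real_line[OF holF _ _ t])
      (auto simp: normF perW[simplified] intro: order_le_less_trans order_less_le_trans)
  then obtain x where x: "x \<in> {0..1 / real N}" and "cmod (F (of_real x)) \<ge> (a * exp (- b * t)) ^ N"
    using lo[of 0] by (meson order_trans)
  then have ge: "cmod (W (of_real x)) \<ge> (a * exp (- b * t)) ^ N" by (simp add: normF)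
  moreover have pos: "(a * exp (- b * t)) ^ N > 0" using a by simp
  ultimately have "W (of_real x) \<noteq> 0" by auto
  then have nz: "P (of_real (x + real k / real N)) \<noteq> 0" if "k < N" for k
    using that by (auto simp: W_def sh_def)
  have "real N * (ln a - b * t) = ln ((a * exp (- b * t)) ^ N)"
    using a by (simp add: ln_realpow ln_mult)
  also have "\<dots> \<le> ln (cmod (W (of_real x)))" using ge pos by (subst ln_le_cancel_iff) linarith+
  also have "\<dots> = (\<Sum>k<N. ln (cmod (P (of_real (x + real k / real N)))))"
    unfolding W_def prod_norm[symmetric] using nz by (subst ln_prod) (auto simp: sh_def)
  finally show ?thesis using x nz by blast
qed

text \<open>For an offset in \<open>[0, 1 / N]\<close>, the sample \<open>x + k / N\<close> lies in
  the \<open>k\<close>-th cell. By uniform continuity, for large \<open>N\<close> the function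
  exceeds the sampled value minus \<open>e\<close> on that cell. One good offset for each
  \<open>N\<close> is therefore enough.\<close>

lemma integral_ge_of_shifted_sums:
  fixes h :: "real \<Rightarrow> real"
  assumes cont: "continuous_on {0..1} h"
    and sums: "\<And>N::nat. N > 0 \<Longrightarrow> \<exists>x\<in>{0..1 / real N}. (\<Sum>k<N. h (x + real k / real N)) \<ge> real N * c"
  shows "integral {0..1} h \<ge> c"
proof (rule field_le_epsilon)
  fix e :: real assume e: "e > 0"
  have "uniformly_continuous_on {0..1} h" using cont by (simp add: compact_uniformly_continuous)
  then obtain d where d: "d > 0" and unif: "\<And>x x'. x \<in> {0..1} \<Longrightarrow> x' \<in> {0..1} \<Longrightarrow> dist x' x < d \<Longrightarrow> dist (h x') (h x) < e"
    using e unfolding uniformly_continuous_on_def by blast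
  obtain N :: nat where N: "N > 0" "1 / real N < d" using d
    by (metis nat_approx_posE zero_less_Suc)
  obtain x where x: "x \<in> {0..1 / real N}" and s: "(\<Sum>k<N. h (x + real k / real N)) \<ge> real N * c"
    using sums[OF N(1)] by blast
  have "m \<le> N \<Longrightarrow> integral {0..real m / N} h \<ge> (\<Sum>k<m. (h (x + real k / real N) - e) / N)" for m
  proof (induction m)
    case (Suc m)
    have le: "real m / N \<le> real (Suc m) / N" "real (Suc m) / N \<le> 1" "0 \<le> real m / N"
      using Suc.prems N by (auto simp: divide_simps)
    have int: "h integrable_on {u..w}" if "0 \<le> u" "w \<le> 1" for u w
      using that by (intro integrable_continuous_real continuous_on_subset[OF cont]) auto
    let ?I = "{real m / N..real (Suc m) / N}"
    have "(h (x + real m / N) - e) * (real (Suc m) / N - real m / N) \<le> integral ?I h"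
    proof -
      have w: "real (Suc m) / N = real m / N + 1 / N" by (simp add: add_divide_distrib)
      have "integral ?I (\<lambda>_. h (x + real m / N) - e) \<le> integral ?I h"
      proof (rule integral_le)
        fix z assume z: "z \<in> ?I"
        have "x + real m / N \<in> ?I" using x w by auto
        then have "dist z (x + real m / N) \<le> 1 / N" using z w by (auto simp: dist_real_def)
        moreover have "z \<in> {0..1}" using z le(2) order_trans[OF le(3), of z] by simp
        ultimately have "dist (h z) (h (x + real m / N)) < e"
          using z le \<open>x + real m / N \<in> ?I\<close> N by (intro unif) (auto intro: order_trans)
        then show "h (x + real m / N) - e \<le> h z" by (auto simp: dist_real_def)
      qed (use le int in auto)
      then show ?thesis using le by (simp add: mult.commute)
    qed
    moreover have "real (Suc m) / N - real m / N = 1 / N" by (simp add: diff_divide_distrib[symmetric])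
    moreover have "integral {0..real m / N} h + integral ?I h = integral {0..real (Suc m) / N} h"
      using le int by (intro Henstock_Kurzweil_Integration.integral_combine) auto
    ultimately show ?case using Suc by simp
  qed simp
  from this[of N] have "(\<Sum>k<N. (h (x + real k / real N) - e) / N) \<le> integral {0..1} h" using N by simp
  also have "(\<Sum>k<N. (h (x + real k / real N) - e) / N) = (\<Sum>k<N. h (x + real k / real N)) / N - e"
    using N by (simp add: sum_divide_distrib[symmetric] sum_subtractf diff_divide_distrib)
  finally have "(\<Sum>k<N. h (x + real k / real N)) / N - e \<le> integral {0..1} h" .
  moreover have "c \<le> (\<Sum>k<N. h (x + real k / real N)) / N" using s N by (simp add: field_simps)
  ultimately show "c \<le> integral {0..1} h + e" by linarith
qed

section \<open>Transfer matrices and their norms\<close>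

text \<open>The determinant of the tridiagonal matrix with diagonal \<open>w 1, ..., w n\<close> and
  ones beside it. The ring is general so that the real matrix entry and its complex extension share
  one formula.\<close>

fun continuant :: "(nat \<Rightarrow> 'a::comm_ring_1) \<Rightarrow> nat \<Rightarrow> 'a" where
  "continuant w 0 = 1"
| "continuant w (Suc 0) = w 1"
| "continuant w (Suc (Suc n)) = w (Suc (Suc n)) * continuant w (Suc n) - continuant w n"

text \<open>The extra 1 in the hypothesis pays for the subtracted term, since powers of
  \<open>Q \<ge> 1\<close> increase.\<close>

lemma norm_continuant_le:
  fixes w :: "nat \<Rightarrow> complex"
  assumes w: "\<And>j. cmod (w j) + 1 \<le> Q" shows "cmod (continuant w n) \<le> Q ^ n"
  using w
proof (induction w n rule: continuant.induct)
  case (2 w)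
  then show ?case using 2[of "Suc 0"] by (smt (verit) One_nat_def continuant.simps(2) power_one_right power_Suc0_right)
next
  case (3 w n)
  have Q: "Q \<ge> 1" using 3(3)[of 0] norm_ge_zero[of "w 0"] by linarith
  let ?v = "w (Suc (Suc n))"
  have "cmod (continuant w (Suc (Suc n))) \<le> cmod ?v * cmod (continuant w (Suc n)) + cmod (continuant w n)"
    using norm_triangle_ineq4[of "?v * continuant w (Suc n)" "continuant w n"] by (simp add: norm_mult)
  also have "\<dots> \<le> cmod ?v * Q ^ Suc n + Q ^ n"
    using 3 by (intro add_mono mult_left_mono) auto
  also have "Q ^ n \<le> Q ^ Suc n" using Q by (intro power_increasing) auto
  also have "cmod ?v * Q ^ Suc n + Q ^ Suc n = (cmod ?v + 1) * Q ^ Suc n" by (simp add: algebra_simps)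
  also have "\<dots> \<le> Q * Q ^ Suc n" using 3(3)[of "Suc (Suc n)"] Q by (intro mult_right_mono) auto
  finally show ?case by simp
qed simp

text \<open>Each step multiplies the modulus by at least \<open>a \<ge> 1\<close>. Hence the moduli
  increase, and the subtracted term costs at most one of the \<open>a + 1\<close> units in the next
  step.\<close>

lemma norm_continuant_ge:
  fixes w :: "nat \<Rightarrow> complex"
  assumes w: "\<And>j. cmod (w j) \<ge> a + 1" and a: "a \<ge> 1"
  shows "cmod (continuant w n) \<ge> a ^ n"
proof -
  have step: "cmod (continuant w (Suc n)) \<ge> a * cmod (continuant w n)" for n
  proof (induction n)
    case (Suc n)
    let ?p = "continuant w"
    have "cmod (?p n) \<le> a * cmod (?p n)" using a by (simp add: mult_le_cancel_right1)
    then have le: "cmod (?p n) \<le> cmod (?p (Suc n))" using Suc by linarith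
    have "(a + 1) * cmod (?p (Suc n)) \<le> cmod (w (Suc (Suc n))) * cmod (?p (Suc n))"
      by (intro mult_right_mono w) auto
    moreover have "cmod (w (Suc (Suc n))) * cmod (?p (Suc n)) - cmod (?p n) \<le> cmod (?p (Suc (Suc n)))"
      using norm_triangle_ineq2[of "w (Suc (Suc n)) * ?p (Suc n)" "?p n"] by (simp add: norm_mult)
    ultimately show ?case using le by (simp add: algebra_simps)
  qed (use w[of 1] in simp)
  show ?thesis
  proof (induction n)
    case (Suc n)
    have "a * a ^ n \<le> a * cmod (continuant w n)" using Suc a by (intro mult_left_mono) auto
    then show ?case using step[of n] by simp
  qed simp
qed

lemma holomorphic_on_continuant:
  assumes "\<And>j. (\<lambda>z. w z j) holomorphic_on S"
  shows "(\<lambda>z. continuant (w z) n) holomorphic_on S"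
proof -
  have "(\<lambda>z. continuant (w z) n) holomorphic_on S \<and> (\<lambda>z. continuant (w z) (Suc n)) holomorphic_on S"
    by (induction n) (auto intro!: holomorphic_intros assms)
  then show ?thesis ..
qed

lemma continuant_of_real:
  "continuant (\<lambda>j. complex_of_real (w j)) n = of_real (continuant w n)"
  by (induction w n rule: continuant.induct) auto

text \<open>The transfer matrix freed from the dynamics: only the sequence of diagonal values
  remains, so moving along an orbit becomes an index shift.\<close>

fun cocycle :: "(nat \<Rightarrow> real) \<Rightarrow> nat \<Rightarrow> real^2^2" where
  "cocycle w 0 = mat 1"
| "cocycle w (Suc n) = (vector [vector [w (Suc n), -1], vector [1, 0]] :: real^2^2) ** cocycle w n"

lemma transfer_matrix_eq_cocycle:
  "transfer_matrix T v lam E n p = cocycle (\<lambda>j. E - lam * v (fst ((T ^^ j) p))) n"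
  by (induction n) auto

lemma cocycle_add: "cocycle w (m + n) = cocycle (\<lambda>j. w (m + j)) n ** cocycle w m"
  by (induction n) (simp_all add: matrix_mul_assoc)

lemma cocycle_entry: "cocycle w n $ 1 $ 1 = continuant w n"
proof -
  \<comment> \<open>The recurrence has order two, so the induction carries two consecutive values
    and the lower left entry.\<close>
  have "cocycle w n $ 1 $ 1 = continuant w n \<and> cocycle w (Suc n) $ 1 $ 1 = continuant w (Suc n) \<and>
    cocycle w (Suc n) $ 2 $ 1 = continuant w n"
    by (induction n) (auto simp: matrix_matrix_mult_def sum_2 mat_def)
  then show ?thesis by blast
qed

section \<open>Unimodularity and operator norms\<close>

lemma det_cocycle: "det (cocycle w n) = 1"
  proof (induction n)
  case (Suc n)
  then show ?case by (simp add: det_mul) (simp add: det_2)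
qed simp

definition log_norm :: "(nat \<Rightarrow> real) \<Rightarrow> nat \<Rightarrow> real" where
  "log_norm w n = ln (onorm ((*v) (cocycle w n)))"

lemma onorm_matrix_mult_le:
  fixes A B :: "real^2^2"
  shows "onorm ((*v) (A ** B)) \<le> onorm ((*v) A) * onorm ((*v) B)"
  using onorm_compose[of "(*v) A" "(*v) B"] by (simp add: o_def matrix_vector_mul_assoc)

text \<open>Hadamard's inequality: the determinant is at most the product of the column lengths, and
  each column is the image of a unit vector.\<close>

lemma abs_det_le_onorm_sq:
  fixes A :: "real^2^2"
  shows "\<bar>det A\<bar> \<le> (onorm ((*v) A))\<^sup>2"
proof -
  have col: "(A $ 1 $ j)\<^sup>2 + (A $ 2 $ j)\<^sup>2 \<le> (onorm ((*v) A))\<^sup>2" for j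
  proof -
    have "norm (A *v axis j 1) \<le> onorm ((*v) A) * norm (axis j (1::real) :: real^2)"
      by (intro onorm) simp
    then have "(norm (column j A))\<^sup>2 \<le> (onorm ((*v) A))\<^sup>2"
      by (intro power_mono) (auto simp: matrix_vector_mult_basis)
    then show ?thesis by (simp add: norm_vec_def L2_set_def sum_2 column_def)
  qed
  have "(det A)\<^sup>2 \<le> ((A $ 1 $ 1)\<^sup>2 + (A $ 2 $ 1)\<^sup>2) * ((A $ 1 $ 2)\<^sup>2 + (A $ 2 $ 2)\<^sup>2)"
  proof -
    \<comment> \<open>Lagrange's identity: the defect is the squared inner product of the
      columns.\<close>
    have "((A $ 1 $ 1)\<^sup>2 + (A $ 2 $ 1)\<^sup>2) * ((A $ 1 $ 2)\<^sup>2 + (A $ 2 $ 2)\<^sup>2) - (det A)\<^sup>2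
      = (A $ 1 $ 1 * A $ 1 $ 2 + A $ 2 $ 1 * A $ 2 $ 2)\<^sup>2"
      unfolding det_2 by (simp add: power2_eq_square algebra_simps)
    then show ?thesis using zero_le_power2[of "A $ 1 $ 1 * A $ 1 $ 2 + A $ 2 $ 1 * A $ 2 $ 2"] by linarith
  qed
  also have "\<dots> \<le> (onorm ((*v) A))\<^sup>2 * (onorm ((*v) A))\<^sup>2"
    by (intro mult_mono col) auto
  finally have "\<bar>det A\<bar>\<^sup>2 \<le> ((onorm ((*v) A))\<^sup>2)\<^sup>2" by (simp add: power2_eq_square)
  then show ?thesis by (rule power2_le_imp_le) simp
qed

lemma onorm_cocycle_ge_1: "onorm ((*v) (cocycle w n)) \<ge> 1"
proof -
  have "1\<^sup>2 \<le> (onorm ((*v) (cocycle w n)))\<^sup>2"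
    using abs_det_le_onorm_sq[of "cocycle w n"] by (simp add: det_cocycle)
  then show ?thesis by (rule power2_le_imp_le) (simp add: onorm_pos_le)
qed

lemma log_norm_nonneg: "log_norm w n \<ge> 0"
  unfolding log_norm_def using onorm_cocycle_ge_1 by simp

text \<open>Submultiplicativity of the norm. Along an orbit the shifted sequence belongs to the
  \<open>m\<close>-th iterate of the starting point, so integration will give subadditivity.\<close>

lemma log_norm_add: "log_norm w (m + n) \<le> log_norm (\<lambda>j. w (m + j)) n + log_norm w m"
proof -
  have pos: "onorm ((*v) (cocycle w n)) > 0" for w n
    using onorm_cocycle_ge_1[of w n] by linarith
  have "onorm ((*v) (cocycle w (m + n))) \<le>
      onorm ((*v) (cocycle (\<lambda>j. w (m + j)) n)) * onorm ((*v) (cocycle w m))"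
    unfolding cocycle_add by (rule onorm_matrix_mult_le)
  then have "log_norm w (m + n) \<le> ln (onorm ((*v) (cocycle (\<lambda>j. w (m + j)) n)) * onorm ((*v) (cocycle w m)))"
    unfolding log_norm_def by (subst ln_le_cancel_iff) (auto intro: pos mult_pos_pos)
  also have "\<dots> = log_norm (\<lambda>j. w (m + j)) n + log_norm w m"
    unfolding log_norm_def by (intro ln_mult_pos pos)
  finally show ?thesis .
qed

lemma log_norm_ge_continuant:
  assumes "continuant w n \<noteq> 0" shows "ln \<bar>continuant w n\<bar> \<le> log_norm w n"
  unfolding log_norm_def using assms matrix_component_le_onorm[of "cocycle w n" 1 1]
  by (subst ln_le_cancel_iff) (auto simp: cocycle_entry intro: order_less_le_trans)

text \<open>The norm of one factor is at most the sum of its absolute entries; the 2 accounts for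
  the entries 1 and -1.\<close>

lemma log_norm_le:
  assumes w: "\<And>j. \<bar>w j\<bar> + 2 \<le> Q" shows "log_norm w n \<le> real n * ln Q"
proof -
  have Q: "Q > 0" using w[of 0] by linarith
  have "onorm ((*v) (cocycle w n)) \<le> Q ^ n"
  proof (induction n)
    case (Suc n)
    let ?A = "vector [vector [w (Suc n), -1], vector [1, 0]] :: real^2^2"
    have "onorm ((*v) ?A) \<le> (\<Sum>i\<in>UNIV. \<Sum>j\<in>UNIV. \<bar>?A $ i $ j\<bar>)" by (rule onorm_le_matrix_component_sum)
    also have "\<dots> \<le> Q" using w[of "Suc n"] by (simp add: sum_2)
    finally have "onorm ((*v) ?A) \<le> Q" .
    then have "onorm ((*v) ?A) * onorm ((*v) (cocycle w n)) \<le> Q * Q ^ n"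
      using Suc Q by (intro mult_mono) (auto simp: onorm_pos_le)
    then show ?case using onorm_matrix_mult_le[of ?A "cocycle w n"] by simp
  qed (simp add: onorm_id[unfolded id_def])
  then have "log_norm w n \<le> ln (Q ^ n)"
    unfolding log_norm_def using onorm_cocycle_ge_1[of w n] Q by (subst ln_le_cancel_iff) auto
  then show ?thesis using Q by (simp add: ln_realpow)
qed

section \<open>Continuity and measurability of \<open>log_norm\<close>\<close>

lemma continuous_on_onorm:
  "continuous_on UNIV (\<lambda>A::real^2^2. onorm ((*v) A))"
proof (rule lipschitz_on_continuous_on[where L = 4], rule lipschitz_onI)
  fix A B :: "real^2^2"
  have le: "onorm ((*v) A) - onorm ((*v) B) \<le> 4 * norm (A - B)" for A B :: "real^2^2"
  proof -
    have "onorm ((*v) (A - B)) \<le> real CARD(2) * real CARD(2) * norm (A - B)"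
    proof (rule onorm_le_matrix_component)
      fix i j :: 2
      have "\<bar>(A - B) $ i $ j\<bar> \<le> norm ((A - B) $ i)" by (rule component_le_norm_cart)
      also have "\<dots> \<le> norm (A - B)" by (rule Finite_Cartesian_Product.norm_nth_le)
      finally show "\<bar>(A - B) $ i $ j\<bar> \<le> norm (A - B)" .
    qed
    moreover have "onorm (\<lambda>x. (A - B) *v x + B *v x) \<le> onorm ((*v) (A - B)) + onorm ((*v) B)"
      by (intro onorm_triangle) auto
    ultimately show ?thesis by (simp add: matrix_vector_mult_diff_rdistrib)
  qed
  show "dist (onorm ((*v) A)) (onorm ((*v) B)) \<le> 4 * dist A B"
    using le[of A B] le[of B A] by (simp add: dist_real_def dist_norm norm_minus_commute)
qed simp

lemma cocycle_Suc_entry: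
  "cocycle w (Suc n) $ i $ j =
     (if i = 1 then w (Suc n) * cocycle w n $ 1 $ j - cocycle w n $ 2 $ j else cocycle w n $ 1 $ j)"
  using exhaust_2[of i] by (auto simp: matrix_matrix_mult_def sum_2)

lemma continuous_on_log_norm:
  assumes "\<And>j. continuous_on S (\<lambda>x. w x j)"
  shows "continuous_on S (\<lambda>x. log_norm (w x) n)"
proof -
  have "continuous_on S (\<lambda>x. cocycle (w x) n $ i $ j)" for i j
  proof (induction n arbitrary: i j)
    case (Suc n)
    show ?case unfolding cocycle_Suc_entry
      by (cases "i = 1") (auto intro!: continuous_intros assms Suc)
  qed (simp add: mat_def)
  then have "continuous_on S (\<lambda>x. \<chi> i j. cocycle (w x) n $ i $ j)"
    by (intro continuous_on_vec_lambda)
  then have "continuous_on S (\<lambda>x. cocycle (w x) n)" by simp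
  then have "continuous_on S (\<lambda>x. onorm ((*v) (cocycle (w x) n)))"
    by (rule continuous_on_compose2[OF continuous_on_onorm]) auto
  then show ?thesis unfolding log_norm_def
    using onorm_cocycle_ge_1 by (intro continuous_on_ln) (auto, metis not_one_le_zero)
qed

lemma borel_measurable_log_norm:
  assumes [measurable]: "\<And>j. (\<lambda>x. w x j) \<in> borel_measurable M"
  shows "(\<lambda>x. log_norm (w x) n) \<in> borel_measurable M"
proof -
  have "(\<lambda>x. cocycle (w x) n $ i $ j) \<in> borel_measurable M" for i j
  proof (induction n arbitrary: i j)
    case (Suc n)
    show ?case unfolding cocycle_Suc_entry
      by (cases "i = 1") (auto intro!: borel_measurable_diff borel_measurable_times assms Suc)
  qed (simp add: mat_def)
  then have "(\<lambda>x. cocycle (w x) n) \<in> borel_measurable M"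
    by (subst borel_measurable_euclidean_space) (auto simp: Basis_vec_def inner_axis)
  then have "(\<lambda>x. onorm ((*v) (cocycle (w x) n))) \<in> borel_measurable M"
    using measurable_compose borel_measurable_continuous_onI[OF continuous_on_onorm] by blast
  then show ?thesis unfolding log_norm_def by (rule borel_measurable_ln)
qed

section \<open>Lower bound for the mean logarithmic norm\<close>

text \<open>The real shifts \<open>s j\<close> preserve horizontal lines, so the bounds on
  \<open>V\<close> apply to every factor. The continuant is at least
  \<open>(lam * \<epsilon> / 2) ^ n\<close> on \<open>Im z = t\<close> and at most
  \<open>(lam * (K + 1)) ^ n\<close> on \<open>Im z = \<rho>\<close>. The powers of
  \<open>lam\<close> cancel in the comparison, which is why \<open>less\<close> does not involve
  \<open>lam\<close>.\<close>

lemma log_norm_integral_ge_line: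
  fixes V :: "complex \<Rightarrow> complex" and v :: "real \<Rightarrow> real"
  assumes hol: "V holomorphic_on {z. \<bar>Im z\<bar> < R}"
    and per: "\<And>z. \<bar>Im z\<bar> < R \<Longrightarrow> V (z + 1) = V z"
    and Vv: "\<And>x. V (complex_of_real x) = of_real (v x)"
    and t: "0 < t" "t < \<rho>" "\<rho> < R" and \<epsilon>: "\<epsilon> > 0"
    and lower: "\<And>x. cmod (V (Complex x t) - of_real e) \<ge> \<epsilon>"
    and upper: "\<And>x. cmod (V (Complex x \<rho>) - of_real e) \<le> K"
    and less: "(K + 1) * exp (- b * \<rho>) < \<epsilon> / 2 * exp (- b * t)"
    and lam: "lam \<ge> 1" "lam * \<epsilon> \<ge> 2" and n: "n > 0"
  shows "integral {0..1} (\<lambda>x. log_norm (\<lambda>j. lam * (e - v (x + s j))) n)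
    \<ge> real n * (ln lam + (ln (\<epsilon> / 2) - b * t))"
proof -
  have contv: "continuous_on UNIV v"
    using t by (intro continuous_on_real_restriction[OF hol _ Vv]) simp
  have K: "K \<ge> 0" using upper[of 0] norm_ge_zero order_trans by blast
  define w where "w z j = complex_of_real lam * (of_real e - V (z + of_real (s j)))" for z j
  define P where "P z = continuant (w z) n" for z
  have w_line: "cmod (w (Complex x y) j) = lam * cmod (V (Complex (x + s j) y) - of_real e)" for x y j
  proof -
    have "Complex x y + of_real (s j) = Complex (x + s j) y" by (simp add: complex_eq_iff)
    then show ?thesis using lam by (simp add: w_def norm_mult norm_minus_commute)
  qed
  have holP: "P holomorphic_on {z. \<bar>Im z\<bar> < R}"
    unfolding P_def
  proof (rule holomorphic_on_continuant)
    fix j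
    have "(\<lambda>z. V (z + of_real (s j))) holomorphic_on {z. \<bar>Im z\<bar> < R}"
      by (rule holomorphic_on_compose_gen[OF _ hol, unfolded o_def]) (auto intro!: holomorphic_intros)
    then show "(\<lambda>z. w z j) holomorphic_on {z. \<bar>Im z\<bar> < R}"
      unfolding w_def by (intro holomorphic_intros)
  qed
  have perP: "P (z + 1) = P z" if "\<bar>Im z\<bar> < R" for z
  proof -
    have "V (z + 1 + of_real (s j)) = V (z + of_real (s j))" for j
      using per[of "z + of_real (s j)"] that by (simp add: add_ac)
    then have "w (z + 1) = w z" by (simp add: w_def fun_eq_iff)
    then show ?thesis by (simp add: P_def)
  qed
  have P_lower: "cmod (P (Complex x t)) \<ge> (lam * \<epsilon> / 2) ^ n" for x
    unfolding P_def
  proof (rule norm_continuant_ge)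
    fix j
    have "lam * \<epsilon> \<le> lam * cmod (V (Complex (x + s j) t) - of_real e)"
      using lower lam by (intro mult_left_mono) auto
    then show "lam * \<epsilon> / 2 + 1 \<le> cmod (w (Complex x t) j)" unfolding w_line using lam by linarith
  qed (use lam in simp)
  have P_upper: "cmod (P (Complex x \<rho>)) \<le> (lam * (K + 1)) ^ n" for x
    unfolding P_def
  proof (rule norm_continuant_le)
    fix j
    have "lam * cmod (V (Complex (x + s j) \<rho>) - of_real e) \<le> lam * K"
      using upper lam by (intro mult_left_mono) auto
    then show "cmod (w (Complex x \<rho>) j) + 1 \<le> lam * (K + 1)"
      unfolding w_line using lam distrib_left[of lam K 1] by linarith
  qed
  \<comment> \<open>The decay rate is taken as \<open>real n * b\<close>, so the required comparison
    is the \<open>n\<close>-th power of \<open>less\<close>.\<close>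
  have expn: "exp (- (real n * b) * y) = exp (- b * y) ^ n" for y
    by (simp add: exp_of_nat_mult[symmetric] mult.assoc)
  have "lam * ((K + 1) * exp (- b * \<rho>)) < lam * (\<epsilon> / 2 * exp (- b * t))"
    using less lam by (intro mult_strict_left_mono) auto
  then have "(lam * ((K + 1) * exp (- b * \<rho>))) ^ n < (lam * (\<epsilon> / 2 * exp (- b * t))) ^ n"
    using lam K n by (intro power_strict_mono) auto
  then have lessP: "(lam * (K + 1)) ^ n * exp (- (real n * b) * \<rho>) < (lam * \<epsilon> / 2) ^ n * exp (- (real n * b) * t)"
    unfolding expn power_mult_distrib[symmetric] by (simp add: mult.assoc)
  show ?thesis
  proof (rule integral_ge_of_shifted_sums)
    show "continuous_on {0..1} (\<lambda>x. log_norm (\<lambda>j. lam * (e - v (x + s j))) n)"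
      by (intro continuous_on_log_norm continuous_intros continuous_on_compose2[OF contv]) auto
    fix N :: nat assume N: "N > 0"
    obtain x where x: "x \<in> {0..1 / real N}" and nz: "\<And>k. k < N \<Longrightarrow> P (of_real (x + real k / real N)) \<noteq> 0"
      and sum: "(\<Sum>k<N. ln (cmod (P (of_real (x + real k / real N))))) \<ge>
         real N * (ln ((lam * \<epsilon> / 2) ^ n) - real n * b * t)"
      using shifted_log_sum_lower_bound[OF holP perP t N P_lower _ P_upper lessP] lam \<epsilon> by auto
    have P_real: "P (of_real u) = of_real (continuant (\<lambda>j. lam * (e - v (u + s j))) n)" for u
    proof -
      have "w (of_real u) = (\<lambda>j. complex_of_real (lam * (e - v (u + s j))))"
        using Vv[of "u + s _"] by (simp add: w_def fun_eq_iff)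
      then show ?thesis unfolding P_def by (simp only: continuant_of_real)
    qed
    have "ln (cmod (P (of_real (x + real k / real N)))) \<le>
      log_norm (\<lambda>j. lam * (e - v (x + real k / real N + s j))) n" if "k < N" for k
      using nz[OF that] unfolding P_real norm_of_real of_real_eq_0_iff by (rule log_norm_ge_continuant)
    then have "(\<Sum>k<N. ln (cmod (P (of_real (x + real k / real N))))) \<le>
       (\<Sum>k<N. log_norm (\<lambda>j. lam * (e - v (x + real k / real N + s j))) n)"
      by (intro sum_mono) auto
    moreover have "ln ((lam * \<epsilon> / 2) ^ n) - real n * b * t = real n * (ln lam + (ln (\<epsilon> / 2) - b * t))"
    proof -
      have "ln (lam * (\<epsilon> / 2)) = ln lam + ln (\<epsilon> / 2)"
        using lam \<epsilon> by (intro ln_mult_pos) auto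
      moreover have "lam * (\<epsilon> / 2) > 0" using lam \<epsilon> by simp
      ultimately have "ln ((lam * (\<epsilon> / 2)) ^ n) = real n * (ln lam + ln (\<epsilon> / 2))"
        by (simp only: ln_realpow)
      then show ?thesis by (simp only: times_divide_eq_right) (simp only: algebra_simps)
    qed
    ultimately show "\<exists>x\<in>{0..1 / real N}. real N * (real n * (ln lam + (ln (\<epsilon> / 2) - b * t)))
       \<le> (\<Sum>k<N. log_norm (\<lambda>j. lam * (e - v (x + real k / real N + s j))) n)"
      using x sum by (intro bexI[of _ x]) auto
  qed
qed

section \<open>Bounds on horizontal lines, uniform in the energy\<close>

lemma periodic_line_bounded:
  fixes V :: "complex \<Rightarrow> complex"
  assumes hol: "V holomorphic_on {z. \<bar>Im z\<bar> < R}"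
    and per: "\<And>z. \<bar>Im z\<bar> < R \<Longrightarrow> V (z + 1) = V z" and y: "\<bar>y\<bar> < R"
  shows "\<exists>B. \<forall>x. cmod (V (Complex x y)) \<le> B"
    and "(\<And>x. V (Complex x y) \<noteq> c) \<Longrightarrow> \<exists>\<epsilon>>0. \<forall>x. cmod (V (Complex x y) - c) \<ge> \<epsilon>"
proof -
  have "V (Complex (x + 1) y) = V (Complex x y)" for x
  proof -
    have "Complex (x + 1) y = Complex x y + 1" by (simp add: complex_eq_iff)
    then show ?thesis using per[of "Complex x y"] y by simp
  qed
  then have frac: "V (Complex (frac x) y) = V (Complex x y)" for x
    using periodic_frac[of "\<lambda>x. V (Complex x y)" x] by simp
  have frac_in: "frac x \<in> {0..1}" for x :: real using frac_lt_1[of x] by simp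
  have cont: "continuous_on {0..1} (\<lambda>x. V (Complex x y))"
    using y by (intro continuous_on_compose2[OF holomorphic_on_imp_continuous_on[OF hol]])
      (auto simp: Complex_eq intro!: continuous_intros)
  then obtain a where "\<And>x. x \<in> {0..1} \<Longrightarrow> cmod (V (Complex x y)) \<le> cmod (V (Complex a y))"
    using continuous_attains_sup[of "{0..1}" "\<lambda>x. cmod (V (Complex x y))"] continuous_on_norm by fastforce
  then show "\<exists>B. \<forall>x. cmod (V (Complex x y)) \<le> B" using frac frac_in by metis
  assume ne: "\<And>x. V (Complex x y) \<noteq> c"
  have "continuous_on {0..1} (\<lambda>x. cmod (V (Complex x y) - c))"
    by (intro continuous_intros cont)
  then obtain a where "\<And>x. x \<in> {0..1} \<Longrightarrow> cmod (V (Complex a y) - c) \<le> cmod (V (Complex x y) - c)"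
    using continuous_attains_inf[of "{0..1}" "\<lambda>x. cmod (V (Complex x y) - c)"] by fastforce
  then have "cmod (V (Complex a y) - c) \<le> cmod (V (Complex x y) - c)" for x
    using frac frac_in by metis
  then show "\<exists>\<epsilon>>0. \<forall>x. cmod (V (Complex x y) - c) \<ge> \<epsilon>"
    using ne[of a] by (intro exI[of _ "cmod (V (Complex a y) - c)"]) auto
qed

text \<open>The zeros of the nonconstant function \<open>V - c\<close> are countable, hence so are
  their heights, whereas the interval of admissible heights is uncountable.\<close>

lemma zero_free_line:
  fixes V :: "complex \<Rightarrow> complex"
  assumes hol: "V holomorphic_on {z. \<bar>Im z\<bar> < R}" and nc: "\<not> V constant_on {z. \<bar>Im z\<bar> < R}"
    and \<rho>: "0 < \<rho>" "\<rho> < R"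
  obtains t where "0 < t" "t < \<rho>" "\<And>x. V (Complex x t) \<noteq> c"
proof -
  let ?S = "{z. \<bar>Im z\<bar> < R}"
  let ?Z = "{z \<in> ?S. V z - c = 0}"
  have "countable ?Z"
  proof (rule holomorphic_countable_zeros)
    have "?S = (\<Union>n. {z. \<bar>Im z\<bar> \<le> R - 1 / real (Suc n)})"
    proof (intro set_eqI iffI)
      fix z assume "z \<in> ?S"
      then obtain n where "1 / real (Suc n) < R - \<bar>Im z\<bar>" using nat_approx_posE[of "R - \<bar>Im z\<bar>"] by auto
      then show "z \<in> (\<Union>n. {z. \<bar>Im z\<bar> \<le> R - 1 / real (Suc n)})" by (intro UN_I[of n]) auto
    next
      fix z assume "z \<in> (\<Union>n. {z. \<bar>Im z\<bar> \<le> R - 1 / real (Suc n)})"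
      then obtain n where "\<bar>Im z\<bar> \<le> R - 1 / real (Suc n)" by blast
      moreover have "1 / real (Suc n) > 0" by simp
      ultimately have "\<bar>Im z\<bar> < R" by linarith
      then show "z \<in> ?S" by simp
    qed
    also have "fsigma \<dots>"
      by (intro fsigma.intros closed_Collect_le continuous_intros)
    finally show "fsigma ?S" .
    show "\<not> (\<lambda>z. V z - c) constant_on ?S" using nc unfolding constant_on_def
      by (metis diff_add_cancel)
  qed (auto intro!: holomorphic_intros hol open_strip connected_strip)
  then have "countable (Im ` ?Z)" by simp
  moreover have "uncountable {0<..<\<rho>}" using \<rho> by (simp add: uncountable_open_interval)
  ultimately have "\<not> {0<..<\<rho>} \<subseteq> Im ` ?Z" by (meson countable_subset)
  then obtain t where t: "t \<in> {0<..<\<rho>}" "t \<notin> Im ` ?Z" by (meson subsetI)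
  have "V (Complex x t) \<noteq> c" for x
  proof
    assume "V (Complex x t) = c"
    then have "Complex x t \<in> ?Z" using t \<rho> by simp
    then have "Im (Complex x t) \<in> Im ` ?Z" by (rule imageI)
    then show False using t by simp
  qed
  then show ?thesis using t by (intro that[of t]) auto
qed

text \<open>For each \<open>e0\<close> there is a line on which \<open>V\<close> stays at a distance
  \<open>d\<close> from \<open>e0\<close>; the same line serves all \<open>e\<close> within
  \<open>d / 2\<close>. Finitely many such neighbourhoods cover \<open>[-K, K]\<close>, so maxima
  over the centres give uniform constants.\<close>

lemma log_norm_integral_ge:
  assumes an: "real_analytic v" and per: "periodic1 v" and nc: "\<not> v constant_on UNIV"
  shows "\<exists>C \<Lambda>. \<forall>e lam s n. \<bar>e\<bar> \<le> K \<longrightarrow> lam \<ge> \<Lambda> \<longrightarrow> n > 0 \<longrightarrow>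
     integral {0..1} (\<lambda>x. log_norm (\<lambda>j. lam * (e - v (x + s j))) n) \<ge> real n * (ln lam - C)"
proof -
  obtain R V where R: "R > 0" and hol: "V holomorphic_on {z. \<bar>Im z\<bar> < R}"
    and Vv: "\<And>x. V (complex_of_real x) = of_real (v x)"
    and perV: "\<And>z. \<bar>Im z\<bar> < R \<Longrightarrow> V (z + 1) = V z"
    using real_analytic_strip_extension[OF an per] by blast
  have ncV: "\<not> V constant_on {z. \<bar>Im z\<bar> < R}"
  proof
    assume "V constant_on {z. \<bar>Im z\<bar> < R}"
    then obtain c where "\<And>z. \<bar>Im z\<bar> < R \<Longrightarrow> V z = c" unfolding constant_on_def by auto
    then have "complex_of_real (v x) = c" for x using Vv[of x] R by simp
    then have "v x = Re c" for x by (metis Re_complex_of_real)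
    then show False using nc unfolding constant_on_def by blast
  qed
  define \<rho> where "\<rho> = R / 2"
  have \<rho>: "0 < \<rho>" "\<rho> < R" using R by (auto simp: \<rho>_def)
  obtain B where B: "\<And>x. cmod (V (Complex x \<rho>)) \<le> B"
    using periodic_line_bounded(1)[OF hol perV, of \<rho>] \<rho> by auto
  have B0: "B \<ge> 0" using B[of 0] norm_ge_zero order_trans by blast
  have "\<exists>\<epsilon>>0. \<exists>C \<Lambda>. \<forall>e lam s n. \<bar>e\<bar> \<le> K \<longrightarrow> \<bar>e - e0\<bar> < \<epsilon> \<longrightarrow> lam \<ge> \<Lambda> \<longrightarrow> n > 0 \<longrightarrow>
     integral {0..1} (\<lambda>x. log_norm (\<lambda>j. lam * (e - v (x + s j))) n) \<ge> real n * (ln lam - C)" for e0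
  proof -
    obtain t where t: "0 < t" "t < \<rho>" and ne: "\<And>x. V (Complex x t) \<noteq> complex_of_real e0"
      using zero_free_line[OF hol ncV \<rho>] by blast
    obtain d where d: "d > 0" and dle: "\<And>x. cmod (V (Complex x t) - of_real e0) \<ge> d"
      using periodic_line_bounded(2)[OF hol perV _ ne] t \<rho> by auto
    define \<epsilon> where "\<epsilon> = d / 2"
    have \<epsilon>: "\<epsilon> > 0" using d by (simp add: \<epsilon>_def)
    define K' where "K' = B + \<bar>K\<bar>"
    have K': "K' \<ge> 0" using B0 by (simp add: K'_def)
    \<comment> \<open>Chosen so that \<open>exp (b * (\<rho> - t))\<close> exceeds
      \<open>2 * (K' + 1) / \<epsilon>\<close>; the added 1 makes this strict.\<close>
    define b where "b = (ln (2 * (K' + 1) / \<epsilon>) + 1) / (\<rho> - t)"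
    have less: "(K' + 1) * exp (- b * \<rho>) < \<epsilon> / 2 * exp (- b * t)"
    proof -
      have "b * (\<rho> - t) > ln (2 * (K' + 1) / \<epsilon>)" using t by (simp add: b_def)
      then have "exp (b * (\<rho> - t)) > exp (ln (2 * (K' + 1) / \<epsilon>))" by simp
      also have "exp (ln (2 * (K' + 1) / \<epsilon>)) = 2 * (K' + 1) / \<epsilon>" using K' \<epsilon> by simp
      finally have "2 * (K' + 1) / \<epsilon> * exp (- b * \<rho>) < exp (b * (\<rho> - t)) * exp (- b * \<rho>)"
        by (intro mult_strict_right_mono) auto
      also have "exp (b * (\<rho> - t)) * exp (- b * \<rho>) = exp (- b * t)"
        by (simp add: exp_add[symmetric] algebra_simps)
      finally show ?thesis using \<epsilon> by (simp add: field_simps)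
    qed
    \<comment> \<open>The constant \<open>b * t - ln (\<epsilon> / 2)\<close> is the loss in the
      estimate from the line; the threshold secures \<open>lam \<ge> 1\<close> and
      \<open>lam * \<epsilon> \<ge> 2\<close>.\<close>
    show ?thesis
    proof (rule exI[of _ \<epsilon>], rule conjI[OF \<epsilon>], rule exI[of _ "b * t - ln (\<epsilon> / 2)"],
        rule exI[of _ "max 1 (2 / \<epsilon>)"], intro allI impI)
      fix e lam :: real and s :: "nat \<Rightarrow> real" and n :: nat
      assume e: "\<bar>e\<bar> \<le> K" "\<bar>e - e0\<bar> < \<epsilon>" and lam: "lam \<ge> max 1 (2 / \<epsilon>)" and n: "n > 0"
      have "cmod (V (Complex x t) - of_real e) \<ge> \<epsilon>" for x
      proof -
        have "cmod (V (Complex x t) - of_real e0) \<le> cmod (V (Complex x t) - of_real e) + cmod (complex_of_real (e - e0))"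
          using norm_triangle_ineq[of "V (Complex x t) - of_real e" "complex_of_real (e - e0)"] by simp
        then show ?thesis using dle[of x] e unfolding norm_of_real by (simp add: \<epsilon>_def)
      qed
      moreover have "cmod (V (Complex x \<rho>) - of_real e) \<le> K'" for x
        using norm_triangle_ineq4[of "V (Complex x \<rho>)" "of_real e"] B[of x] e by (simp add: K'_def)
      moreover have "lam \<ge> 1" "lam * \<epsilon> \<ge> 2" using lam \<epsilon> by (auto simp: field_simps)
      ultimately have "real n * (ln lam + (ln (\<epsilon> / 2) - b * t)) \<le>
         integral {0..1} (\<lambda>x. log_norm (\<lambda>j. lam * (e - v (x + s j))) n)"
        by (intro log_norm_integral_ge_line[OF hol perV Vv t \<rho>(2) \<epsilon> _ _ less _ _ n]) auto
      then show "real n * (ln lam - (b * t - ln (\<epsilon> / 2))) \<le>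
         integral {0..1} (\<lambda>x. log_norm (\<lambda>j. lam * (e - v (x + s j))) n)"
        by (simp add: algebra_simps)
    qed
  qed
  then obtain \<epsilon> C \<Lambda> where \<epsilon>: "\<And>e0. \<epsilon> e0 > 0" and
    loc: "\<And>e0 e lam s n. \<bar>e\<bar> \<le> K \<Longrightarrow> \<bar>e - e0\<bar> < \<epsilon> e0 \<Longrightarrow> lam \<ge> \<Lambda> e0 \<Longrightarrow> n > 0 \<Longrightarrow>
     integral {0..1} (\<lambda>x. log_norm (\<lambda>j. lam * (e - v (x + s j))) n) \<ge> real n * (ln lam - C e0)"
    by metis
  obtain D where D: "finite D" "{-K..K} \<subseteq> (\<Union>e0\<in>D. ball e0 (\<epsilon> e0))"
  proof (rule compactE_image[of "{-K..K}" UNIV "\<lambda>e0. ball e0 (\<epsilon> e0)"])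
    show "{-K..K} \<subseteq> (\<Union>e0. ball e0 (\<epsilon> e0))" using \<epsilon> centre_in_ball by blast
  qed auto
  obtain Cm where Cm: "\<And>e0. e0 \<in> D \<Longrightarrow> C e0 \<le> Cm"
    using bdd_above_finite[of "C ` D"] D(1) unfolding bdd_above_def by auto
  obtain \<Lambda>m where \<Lambda>m: "\<And>e0. e0 \<in> D \<Longrightarrow> \<Lambda> e0 \<le> \<Lambda>m"
    using bdd_above_finite[of "\<Lambda> ` D"] D(1) unfolding bdd_above_def by auto
  show ?thesis
  proof (rule exI[of _ Cm], rule exI[of _ \<Lambda>m], intro allI impI)
    fix e lam :: real and s :: "nat \<Rightarrow> real" and n :: nat
    assume e: "\<bar>e\<bar> \<le> K" and lam: "lam \<ge> \<Lambda>m" and n: "n > 0"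
    from e have "e \<in> {-K..K}" by auto
    then obtain e0 where e0: "e0 \<in> D" "\<bar>e - e0\<bar> < \<epsilon> e0" using D(2) by (auto simp: dist_real_def abs_minus_commute)
    have "real n * (ln lam - Cm) \<le> real n * (ln lam - C e0)"
      using Cm[OF e0(1)] by (intro mult_left_mono) auto
    also have "\<dots> \<le> integral {0..1} (\<lambda>x. log_norm (\<lambda>j. lam * (e - v (x + s j))) n)"
      using loc[OF e e0(2) _ n] \<Lambda>m[OF e0(1)] lam by auto
    finally show "real n * (ln lam - Cm) \<le> integral {0..1} (\<lambda>x. log_norm (\<lambda>j. lam * (e - v (x + s j))) n)" .
  qed
qed

section \<open>Bounds for the Lyapunov exponent\<close>

text \<open>Fekete's lemma: the averages converge to their infimum. Nonnegativity keeps the infimum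
  finite and bounds every remainder term by the sum \<open>B\<close>.\<close>

lemma subadditive_convergent:
  fixes a :: "nat \<Rightarrow> real"
  assumes sub: "\<And>m n. a (m + n) \<le> a m + a n" and nonneg: "\<And>n. a n \<ge> 0"
  shows "convergent (\<lambda>n. 1 / real n * a n)"
proof -
  define L where "L = (INF n\<in>{1..}. a n / real n)"
  have bdd: "bdd_below ((\<lambda>n. a n / real n) ` {1..})"
    using nonneg by (intro bdd_belowI2[of _ 0]) simp
  have le: "L \<le> a n / real n" if "n \<ge> 1" for n
    unfolding L_def by (rule cINF_lower[OF bdd]) (use that in simp)
  \<comment> \<open>The case \<open>q = 0\<close> is excluded because \<open>a 0\<close> may be
    positive.\<close>
  have mult: "a (q * m) \<le> real q * a m" if "q \<ge> 1" for q m
    using that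
  proof (induction q rule: dec_induct)
    case (step q)
    then show ?case using sub[of m "q * m"] by (simp add: algebra_simps)
  qed simp
  have "(\<lambda>n. a n / real n) \<longlonglongrightarrow> L"
  proof (rule tendstoI)
    fix e :: real assume e: "e > 0"
    obtain m where m: "m \<ge> 1" "a m / real m < L + e / 2"
      using cINF_less_iff[OF _ bdd, of "L + e / 2"] e unfolding L_def by auto
    define B where "B = (\<Sum>r<m. a r)"
    have B: "a r \<le> B" if "r < m" for r
      unfolding B_def using that nonneg by (intro member_le_sum) auto
    have B0: "B \<ge> 0" unfolding B_def by (intro sum_nonneg nonneg)
    obtain n0 :: nat where n0: "real n0 > 2 * B / e" using reals_Archimedean2 by blast
    have "dist (a n / real n) L < e" if n: "n \<ge> max m (Suc n0)" for n
    proof -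
      have n1: "n \<ge> 1" using n by simp
      have q: "n div m \<ge> 1" using n m by (simp add: div_greater_zero_iff Suc_le_eq)
      have "a n \<le> a (n div m * m) + a (n mod m)" using sub[of "n div m * m" "n mod m"] by simp
      also have "\<dots> \<le> real (n div m) * a m + B"
        using mult[OF q, of m] B[of "n mod m"] m by (intro add_mono) auto
      also have "real (n div m) * a m \<le> real n / real m * a m"
        using nonneg by (intro mult_right_mono of_nat_div_le_of_nat)
      finally have "a n / real n \<le> a m / real m + B / real n"
        using n1 m by (simp add: field_simps)
      moreover have "B / real n < e / 2"
      proof -
        have "2 * B / e < real n" using n n0 by linarith
        then show ?thesis using e n1 by (simp add: field_simps)
      qed
      ultimately have "a n / real n < L + e" using m by linarith
      then show ?thesis using le[OF n1] by (simp add: dist_real_def)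
    qed
    then show "\<forall>\<^sub>F n in sequentially. dist (a n / real n) L < e"
      unfolding eventually_sequentially by blast
  qed
  then show ?thesis unfolding convergent_def by auto
qed

section \<open>The circle measure and orbits of the skew shift\<close>

lemma space_circle [simp]: "space circle = {0..<1}"
  by (simp add: circle_def space_restrict_space)

lemma borel_measurable_circle: "h \<in> borel_measurable borel \<Longrightarrow> h \<in> borel_measurable circle"
  unfolding circle_def by (intro measurable_restrict_space1) simp

lemma prob_space_circle: "prob_space circle"
proof
  have "emeasure circle {0..<1} = emeasure lborel {0..<(1::real)}"
    unfolding circle_def by (subst emeasure_restrict_space) auto
  then show "emeasure circle (space circle) = 1" by simp
qed

lemma integral_circle:
  fixes h :: "real \<Rightarrow> real"
  assumes cont: "continuous_on UNIV h"
  shows "(LINT x|circle. h x) = integral {0..1} h"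
proof -
  have int: "set_integrable lborel {0..1} h"
    by (rule borel_integrable_atLeastAtMost') (rule continuous_on_subset[OF cont], simp)
  have "(LINT x|circle. h x) = (LINT x:{0..<1}|lborel. h x)"
    unfolding circle_def set_lebesgue_integral_def by (intro integral_restrict_space) simp
  also have "\<dots> = integral {0..<1} h"
    by (intro set_borel_integral_eq_integral set_integrable_subset[OF int]) auto
  also have "\<dots> = integral {0..1} h"
  proof (rule integral_spike_set)
    have "{x \<in> {0..1} - {0..<1}. h x \<noteq> 0} \<subseteq> {1}" by auto
    then show "negligible {x \<in> {0..1} - {0..<1}. h x \<noteq> 0}"
      using negligible_sing negligible_subset by blast
    have "{x \<in> {0..<1} - {0..1}. h x \<noteq> 0} = {}" by auto
    then show "negligible {x \<in> {0..<1} - {0..1}. h x \<noteq> 0}" by (metis negligible_empty)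
  qed
  finally show ?thesis .
qed

text \<open>Each \<open>frac\<close> changes the first coordinate by an integer, invisible to
  \<open>v\<close>. Hence for fixed \<open>y\<close> the orbit has the form \<open>x + s j\<close>
  treated in the lower bound.\<close>

lemma skew_shift_orbit:
  assumes per: "\<And>x. v (x + 1) = v x"
  shows "v (fst ((skew_shift f g ^^ j) (x, y))) = v (x + (\<Sum>i<j. f ((g ^^ i) y)))"
proof -
  have "snd ((skew_shift f g ^^ j) (x, y)) = (g ^^ j) y \<and>
    (\<exists>k. fst ((skew_shift f g ^^ j) (x, y)) = x + (\<Sum>i<j. f ((g ^^ i) y)) + of_int k)"
  proof (induction j)
    case (Suc j)
    then obtain k where "fst ((skew_shift f g ^^ j) (x, y)) = x + (\<Sum>i<j. f ((g ^^ i) y)) + of_int k" by blast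
    moreover have "(skew_shift f g ^^ Suc j) p = (frac (fst q + f (snd q)), g (snd q))"
      if "q = (skew_shift f g ^^ j) p" for p q
      using that by (simp add: skew_shift_def case_prod_beta)
    from this[OF refl] have "(skew_shift f g ^^ Suc j) (x, y) =
      (frac (fst ((skew_shift f g ^^ j) (x, y)) + f ((g ^^ j) y)), g ((g ^^ j) y))"
      using Suc by metis
    ultimately show ?case
      by (auto simp: frac_def
          intro!: exI[of _ "k - \<lfloor>x + (\<Sum>i<j. f ((g ^^ i) y)) + of_int k + f ((g ^^ j) y)\<rfloor>"])
  qed (auto intro: exI[of _ 0])
  then show ?thesis using periodic_of_int[of v, OF per] by metis
qed

lemma lyapunov_n_eq:
  "lyapunov_n M T v lam E n =
     1 / real n * (LINT y|M. (LINT x|circle. log_norm (\<lambda>j. E - lam * v (fst ((T ^^ j) (x, y)))) n))"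
  by (simp add: lyapunov_n_def log_norm_def transfer_matrix_eq_cocycle)

lemma funpow_measurable:
  assumes "T \<in> measurable N N" shows "T ^^ j \<in> measurable N N"
proof (induction j)
  case (Suc j)
  then show ?case unfolding funpow.simps by (rule measurable_comp[OF _ assms])
qed (simp add: id_def)

lemma log_norm_orbit_measurable:
  assumes v: "v \<in> borel_measurable borel" and T: "T \<in> measurable (circle \<Otimes>\<^sub>M M) (circle \<Otimes>\<^sub>M M)"
  shows "(\<lambda>p. log_norm (\<lambda>j. E - lam * v (fst ((T ^^ j) p))) n) \<in> borel_measurable (circle \<Otimes>\<^sub>M M)"
proof (rule borel_measurable_log_norm)
  fix j
  have "(\<lambda>p. v (fst p)) \<in> borel_measurable (circle \<Otimes>\<^sub>M M)"
    using borel_measurable_circle[OF v] by (rule measurable_compose[OF measurable_fst])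
  then have "(\<lambda>p. v (fst ((T ^^ j) p))) \<in> borel_measurable (circle \<Otimes>\<^sub>M M)"
    by (rule measurable_compose[OF funpow_measurable[OF T]])
  then show "(\<lambda>p. E - lam * v (fst ((T ^^ j) p))) \<in> borel_measurable (circle \<Otimes>\<^sub>M M)"
    by (intro borel_measurable_diff borel_measurable_times) auto
qed

lemma distr_funpow:
  assumes T: "T \<in> measurable N N" and eq: "distr N N T = N"
  shows "distr N N (T ^^ j) = N"
proof (induction j)
  case (Suc j)
  have "distr N N (T ^^ Suc j) = distr (distr N N (T ^^ j)) N T"
    by (subst distr_distr[OF T funpow_measurable[OF T]]) (simp only: funpow.simps)
  then show ?case unfolding Suc eq .
qed (simp add: id_def distr_id)

text \<open>Invariance of the measure makes the integrals subadditive, so the averages converge.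
  Both bounds hold at every \<open>n > 0\<close>, the lower one on each fibre, and pass to the
  limit.\<close>

lemma lyapunov_bounds:
  fixes M :: "'y measure" and f :: "'y \<Rightarrow> real" and g :: "'y \<Rightarrow> 'y"
  defines "T \<equiv> skew_shift f g"
  assumes M: "prob_space M" and mp: "measure_preserving (circle \<Otimes>\<^sub>M M) T"
    and contv: "continuous_on UNIV v" and per: "periodic1 v"
    and Q: "\<And>x. \<bar>E - lam * v x\<bar> + 2 \<le> Q"
    and lower: "\<And>s n. n > 0 \<Longrightarrow>
        integral {0..1} (\<lambda>x. log_norm (\<lambda>j. E - lam * v (x + s j)) n) \<ge> real n * c"
  shows "c \<le> lyapunov M T v lam E \<and> lyapunov M T v lam E \<le> ln Q"
proof -
  interpret M: prob_space M by fact
  interpret C: prob_space circle by (rule prob_space_circle)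
  interpret pair_prob_space circle M ..
  let ?N = "circle \<Otimes>\<^sub>M M"
  define H where "H n p = log_norm (\<lambda>j. E - lam * v (fst ((T ^^ j) p))) n" for n p
  define A where "A n = (LINT p|?N. H n p)" for n
  have T: "T \<in> measurable ?N ?N" "distr ?N ?N T = ?N"
    using mp by (auto simp: measure_preserving_def)
  have H_meas: "H n \<in> borel_measurable ?N" for n
    unfolding H_def
    by (intro log_norm_orbit_measurable T borel_measurable_continuous_onI contv)
  have H0: "H n p \<ge> 0" for n p unfolding H_def by (rule log_norm_nonneg)
  have H1: "H n p \<le> real n * ln Q" for n p unfolding H_def by (intro log_norm_le Q)
  have H_int: "integrable ?N (H n)" for n
    by (rule P.integrable_const_bound[where B = "real n * ln Q"]) (use H0 H1 H_meas in auto)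
  have iter: "(LINT y|M. (LINT x|circle. H n (x, y))) = A n" for n
    unfolding A_def using integral_snd[of "\<lambda>x y. H n (x, y)"] H_int by (simp add: case_prod_beta')
  have Ln: "lyapunov_n M T v lam E n = 1 / real n * A n" for n
    unfolding lyapunov_n_eq iter[symmetric] H_def ..
  have "A (m + n) \<le> A m + A n" for m n
  proof -
    note Tm = funpow_measurable[OF T(1), of m]
    \<comment> \<open>Invariance of the product measure under \<open>T ^^ m\<close> absorbs the
      shift left by \<open>log_norm_add\<close>.\<close>
    have shift: "(LINT p|?N. H n ((T ^^ m) p)) = A n"
      unfolding A_def using integral_distr[OF Tm H_meas] distr_funpow[OF T] by simp
    have int: "integrable ?N (\<lambda>p. H n ((T ^^ m) p))"
      using integrable_distr[OF Tm, of "H n"] H_int distr_funpow[OF T] by simp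
    have "A (m + n) \<le> (LINT p|?N. H n ((T ^^ m) p) + H m p)"
      unfolding A_def
    proof (rule integral_mono[OF H_int Bochner_Integration.integrable_add[OF int H_int]])
      fix p
      have "(T ^^ (m + j)) p = (T ^^ j) ((T ^^ m) p)" for j
        by (subst add.commute) (simp add: funpow_add)
      then show "H (m + n) p \<le> H n ((T ^^ m) p) + H m p"
        unfolding H_def using log_norm_add[of "\<lambda>j. E - lam * v (fst ((T ^^ j) p))" m n] by simp
    qed
    also have "\<dots> = A n + A m" using int H_int by (simp add: shift A_def[symmetric])
    finally show ?thesis by simp
  qed
  moreover have "A n \<ge> 0" for n unfolding A_def using H0 by (intro Bochner_Integration.integral_nonneg)
  ultimately have conv: "(\<lambda>n. 1 / real n * A n) \<longlonglongrightarrow> lyapunov M T v lam E"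
    unfolding lyapunov_def Ln by (intro convergent_LIMSEQ_iff[THEN iffD1] subadditive_convergent)
  have up: "1 / real n * A n \<le> ln Q" if "n > 0" for n
  proof -
    have "A n \<le> real n * ln Q" unfolding A_def
      by (rule P.integral_le_const[OF H_int]) (use H1 in auto)
    then show ?thesis using that by (simp add: field_simps)
  qed
  have lo: "c \<le> 1 / real n * A n" if n: "n > 0" for n
  proof -
    have "real n * c \<le> (LINT x|circle. H n (x, y))" for y
    proof -
      let ?s = "\<lambda>j. \<Sum>i<j. f ((g ^^ i) y)"
      have H: "H n (x, y) = log_norm (\<lambda>j. E - lam * v (x + ?s j)) n" for x
        unfolding H_def T_def using per by (simp add: skew_shift_orbit periodic1_def)
      have "continuous_on UNIV (\<lambda>x. log_norm (\<lambda>j. E - lam * v (x + ?s j)) n)"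
        by (intro continuous_on_log_norm continuous_intros continuous_on_compose2[OF contv]) auto
      then have "(LINT x|circle. H n (x, y)) = integral {0..1} (\<lambda>x. log_norm (\<lambda>j. E - lam * v (x + ?s j)) n)"
        unfolding H by (rule integral_circle)
      then show ?thesis using lower[OF n, of ?s] by simp
    qed
    moreover have "integrable M (\<lambda>y. LINT x|circle. H n (x, y))"
      using integrable_snd[of "\<lambda>x y. H n (x, y)"] H_int by (simp add: case_prod_beta')
    ultimately have "real n * c \<le> A n"
      unfolding iter[symmetric] by (intro M.integral_ge_const) auto
    then show ?thesis using n by (simp add: field_simps)
  qed
  show ?thesis
  proof
    show "c \<le> lyapunov M T v lam E"
      by (rule LIMSEQ_le_const[OF conv]) (use lo in \<open>auto intro!: exI[of _ 1]\<close>)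
    show "lyapunov M T v lam E \<le> ln Q"
      by (rule LIMSEQ_le_const2[OF conv]) (use up in \<open>auto intro!: exI[of _ 1]\<close>)
  qed
qed

section \<open>Existence and transfer of the threshold\<close>

text \<open>Both bounds differ from \<open>ln lam\<close> by constants depending on \<open>v\<close>
  alone, and a large \<open>lam\<close> makes these smaller than \<open>\<kappa> * ln lam\<close>.
  The lower bound is applied at \<open>e = E / lam\<close>, which the spectral estimate confines to
  \<open>\<bar>e\<bar> \<le> B + 1\<close>.\<close>

lemma valid_threshold_exists:
  assumes an: "real_analytic v" and per: "periodic1 v" and nc: "\<not> v constant_on UNIV"
    and \<kappa>: "\<kappa> > 0"
  shows "\<exists>l. valid_threshold TYPE('y) v \<kappa> l"
proof -
  have contv: "continuous_on UNIV v" by (rule real_analytic_continuous_on[OF an per])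
  obtain B where B: "\<And>x. \<bar>v x\<bar> \<le> B"
  proof -
    have "compact (v ` {0..1})"
      by (intro compact_continuous_image continuous_on_subset[OF contv]) auto
    then obtain B where "\<And>x. x \<in> {0..1} \<Longrightarrow> \<bar>v x\<bar> \<le> B"
      using compact_imp_bounded bounded_iff by (metis imageI real_norm_def)
    moreover have "frac x \<in> {0..1}" for x :: real using frac_lt_1[of x] by simp
    moreover have "v (frac x) = v x" for x using per by (intro periodic_frac) (simp add: periodic1_def)
    ultimately show ?thesis using that by metis
  qed
  have B0: "B \<ge> 0" using B[of 0] abs_ge_zero order_trans by blast
  obtain C \<Lambda> where lower: "\<And>e lam s n. \<bar>e\<bar> \<le> B + 1 \<Longrightarrow> lam \<ge> \<Lambda> \<Longrightarrow> n > 0 \<Longrightarrow>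
     integral {0..1} (\<lambda>x. log_norm (\<lambda>j. lam * (e - v (x + s j))) n) \<ge> real n * (ln lam - C)"
    using log_norm_integral_ge[OF an per nc, of "B + 1"] by blast
  \<comment> \<open>The larger of the two errors. In the threshold below, 2 absorbs the additive
    constants into multiples of \<open>lam\<close>, \<open>\<Lambda>\<close> admits the lower bound,
    and \<open>exp (D / \<kappa>)\<close> gives the strict inequality
    \<open>D < \<kappa> * ln lam\<close>.\<close>
  define D where "D = max C (ln (2 * B + 2))"
  show ?thesis
    unfolding valid_threshold_def
  proof (rule exI[of _ "max (max 2 \<Lambda>) (exp (D / \<kappa>))"], intro allI impI)
    fix M :: "'y measure" and f g x y lam E
    assume M: "prob_space M" and mp: "measure_preserving (circle \<Otimes>\<^sub>M M) (skew_shift f g)"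
      and lam: "max (max 2 \<Lambda>) (exp (D / \<kappa>)) < lam"
      and E: "complex_of_real E \<in> ell2_spectrum (schroedinger (skew_shift f g) v lam (x, y))"
    have lam2: "lam > 2" "lam \<ge> \<Lambda>" "exp (D / \<kappa>) < lam" using lam by auto
    have "D / \<kappa> < ln lam" using lam2 ln_less_cancel_iff[of "exp (D / \<kappa>)" lam] by simp
    then have D: "D < \<kappa> * ln lam" using \<kappa> by (simp add: field_simps)
    have "\<bar>E\<bar> \<le> 2 + lam * B"
      using ell2_spectrum_schroedinger_bound[OF B _ E] lam2 by simp
    then have E1: "\<bar>E\<bar> \<le> lam * (B + 1)" using lam2 by (simp add: algebra_simps)
    have "ln lam - C \<le> lyapunov M (skew_shift f g) v lam E \<and>
       lyapunov M (skew_shift f g) v lam E \<le> ln (lam * (2 * B + 2))"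
    proof (rule lyapunov_bounds[OF M mp contv per])
      fix u
      have "\<bar>lam * v u\<bar> \<le> lam * B" using B[of u] lam2 by (simp add: abs_mult)
      then have "\<bar>E - lam * v u\<bar> + 2 \<le> lam * (B + 1) + lam * B + lam"
        using E1 lam2 by linarith
      then show "\<bar>E - lam * v u\<bar> + 2 \<le> lam * (2 * B + 2)" by (simp add: algebra_simps)
    next
      fix s :: "nat \<Rightarrow> real" and n :: nat assume n: "n > 0"
      have "\<bar>E / lam\<bar> \<le> B + 1" using E1 lam2 by (simp add: abs_divide field_simps)
      from lower[OF this lam2(2) n, of s]
      show "real n * (ln lam - C) \<le> integral {0..1} (\<lambda>x. log_norm (\<lambda>j. E - lam * v (x + s j)) n)"
        using lam2 by (simp add: right_diff_distrib)
    qed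
    moreover have "ln (lam * (2 * B + 2)) = ln lam + ln (2 * B + 2)"
      using lam2 B0 by (intro ln_mult_pos) auto
    ultimately show "(1 - \<kappa>) * ln lam < lyapunov M (skew_shift f g) v lam E \<and>
        lyapunov M (skew_shift f g) v lam E < (1 + \<kappa>) * ln lam"
      using D unfolding D_def by (simp add: algebra_simps)
  qed
qed

text \<open>The itinerary map \<open>h\<close> semiconjugates the system to the left shift on
  sequences and preserves first coordinates of orbits, which are all that the operator and the
  transfer matrices see.\<close>

lemma valid_threshold_transfer:
  assumes valid: "valid_threshold TYPE(nat \<Rightarrow> real) v \<kappa> l" and contv: "continuous_on UNIV v"
  shows "valid_threshold TYPE('y) v \<kappa> l"
  unfolding valid_threshold_def
proof (intro allI impI)
  fix M :: "'y measure" and f g x y lam E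
  assume M: "prob_space M" and f: "f \<in> measurable M circle" and g: "g \<in> measurable M M"
    and mp: "measure_preserving (circle \<Otimes>\<^sub>M M) (skew_shift f g)"
    and x: "x \<in> space circle" and y: "y \<in> space M" and lam: "lam > l"
    and E: "complex_of_real E \<in> ell2_spectrum (schroedinger (skew_shift f g) v lam (x, y))"
  interpret M: prob_space M by fact
  interpret C: prob_space circle by (rule prob_space_circle)
  let ?P = "PiM UNIV (\<lambda>_::nat. circle)"
  define h where "h y = (\<lambda>k. f ((g ^^ k) y))" for y
  define M' where "M' = distr M ?P h"
  define f' :: "(nat \<Rightarrow> real) \<Rightarrow> real" where "f' s = s 0" for s
  define g' :: "(nat \<Rightarrow> real) \<Rightarrow> nat \<Rightarrow> real" where "g' s k = s (Suc k)" for s k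
  define h2 where "h2 = (\<lambda>(x::real, y). (x, h y))"
  let ?T = "skew_shift f g" and ?T' = "skew_shift f' g'"
  have h: "h \<in> measurable M ?P"
    unfolding h_def by (rule measurable_PiM_single')
      (auto intro: measurable_compose[OF funpow_measurable[OF g] f] dest: measurable_space[OF f] measurable_space[OF funpow_measurable[OF g]] simp del: space_circle)
  have f'P: "f' \<in> measurable ?P circle"
    unfolding f'_def by (rule measurable_component_singleton) simp
  have g'P: "g' \<in> measurable ?P ?P"
    unfolding g'_def by (rule measurable_PiM_single')
      (auto simp: space_PiM PiE_iff simp del: space_circle intro!: measurable_component_singleton)
  have sets_M': "sets M' = sets ?P" by (simp add: M'_def)
  have sets_N: "sets (circle \<Otimes>\<^sub>M M') = sets (circle \<Otimes>\<^sub>M ?P)"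
    by (rule sets_pair_measure_cong[OF refl sets_M'])
  have f': "f' \<in> measurable M' circle" and g': "g' \<in> measurable M' M'"
    using f'P g'P by (auto simp: M'_def)
  have M': "prob_space M'" unfolding M'_def by (rule M.prob_space_distr[OF h])
  interpret M': prob_space M' by fact
  have T'P: "?T' \<in> measurable (circle \<Otimes>\<^sub>M ?P) (circle \<Otimes>\<^sub>M ?P)"
  proof -
    have id: "(\<lambda>x. x) \<in> measurable circle borel"
      by (rule borel_measurable_circle) simp
    have "(\<lambda>p. frac (fst p + f' (snd p))) \<in> measurable (circle \<Otimes>\<^sub>M ?P) circle"
      unfolding circle_def
    proof (rule measurable_restrict_space2)
      have 1: "(\<lambda>p. fst p) \<in> measurable (circle \<Otimes>\<^sub>M ?P) borel"
        by (rule measurable_compose[OF measurable_fst id])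
      have 2: "(\<lambda>p. f' (snd p)) \<in> measurable (circle \<Otimes>\<^sub>M ?P) borel"
        by (rule measurable_compose[OF measurable_snd measurable_compose[OF f'P id]])
      have "frac \<in> borel_measurable (borel :: real measure)"
        unfolding frac_def[abs_def] by measurable
      then show "(\<lambda>p. frac (fst p + f' (snd p))) \<in> measurable (restrict_space lborel {0..<1} \<Otimes>\<^sub>M PiM UNIV (\<lambda>_. restrict_space lborel {0..<1})) lborel"
        using measurable_compose[OF borel_measurable_add[OF 1 2]] unfolding circle_def by simp
    qed (auto simp: frac_lt_1)
    moreover have "(\<lambda>p. g' (snd p)) \<in> measurable (circle \<Otimes>\<^sub>M ?P) ?P"
      by (rule measurable_compose[OF measurable_snd g'P])
    ultimately have "(\<lambda>p. (frac (fst p + f' (snd p)), g' (snd p))) \<in> measurable (circle \<Otimes>\<^sub>M ?P) (circle \<Otimes>\<^sub>M ?P)"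
      by (rule measurable_Pair)
    then show ?thesis by (simp add: skew_shift_def case_prod_beta')
  qed
  have T: "?T \<in> measurable (circle \<Otimes>\<^sub>M M) (circle \<Otimes>\<^sub>M M)"
    "distr (circle \<Otimes>\<^sub>M M) (circle \<Otimes>\<^sub>M M) ?T = circle \<Otimes>\<^sub>M M"
    using mp by (auto simp: measure_preserving_def)
  have h2: "h2 \<in> measurable (circle \<Otimes>\<^sub>M M) (circle \<Otimes>\<^sub>M ?P)"
    unfolding h2_def case_prod_beta'
    by (intro measurable_Pair measurable_fst measurable_compose[OF measurable_snd h])
  have semi: "?T' \<circ> h2 = h2 \<circ> ?T"
    by (auto simp: fun_eq_iff h2_def skew_shift_def h_def f'_def g'_def funpow_swap1)
  have semi_pow: "(?T' ^^ j) (h2 p) = h2 ((?T ^^ j) p)" for j p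
  proof (induction j)
    case (Suc j)
    then show ?case using fun_cong[OF semi, of "(?T ^^ j) p"] by simp
  qed simp
  have orbit: "fst ((?T' ^^ j) (x, h y)) = fst ((?T ^^ j) (x, y))" for j x y
    using semi_pow[of j "(x, y)"] by (simp add: h2_def case_prod_beta)
  \<comment> \<open>The product with the image measure is the image of the product. With
    \<open>semi\<close>, invariance then passes from the given system to the sequence
    system.\<close>
  have pair: "circle \<Otimes>\<^sub>M M' = distr (circle \<Otimes>\<^sub>M M) (circle \<Otimes>\<^sub>M ?P) h2"
    using pair_measure_distr[of "\<lambda>x. x" circle circle h M ?P] h M'.sigma_finite_measure_axioms
    by (simp add: M'_def h2_def distr_id)
  have mp': "measure_preserving (circle \<Otimes>\<^sub>M M') ?T'"
  proof -
    have meas: "?T' \<in> measurable (circle \<Otimes>\<^sub>M M') (circle \<Otimes>\<^sub>M M')"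
      using T'P by (simp cong: measurable_cong_sets add: measurable_cong_sets[OF sets_N sets_N])
    have "distr (circle \<Otimes>\<^sub>M M') (circle \<Otimes>\<^sub>M M') ?T' = distr (circle \<Otimes>\<^sub>M M') (circle \<Otimes>\<^sub>M ?P) ?T'"
      by (rule distr_cong[OF refl sets_N refl])
    also have "\<dots> = distr (circle \<Otimes>\<^sub>M M) (circle \<Otimes>\<^sub>M ?P) (?T' \<circ> h2)"
      unfolding pair by (rule distr_distr[OF T'P h2])
    also have "\<dots> = distr (distr (circle \<Otimes>\<^sub>M M) (circle \<Otimes>\<^sub>M M) ?T) (circle \<Otimes>\<^sub>M ?P) h2"
      unfolding semi by (rule distr_distr[OF h2 T(1), symmetric])
    also have "\<dots> = circle \<Otimes>\<^sub>M M'" unfolding T(2) pair ..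
    finally show ?thesis using meas by (simp add: measure_preserving_def)
  qed
  have "schroedinger ?T' v lam (x, h y) = schroedinger ?T v lam (x, y)"
    by (simp add: fun_eq_iff schroedinger_def orbit)
  then have E': "complex_of_real E \<in> ell2_spectrum (schroedinger ?T' v lam (x, h y))"
    using E by simp
  have hy: "h y \<in> space M'" using measurable_space[OF h y] by (simp add: M'_def)
  have "lyapunov_n M' ?T' v lam E n = lyapunov_n M ?T v lam E n" for n
  proof -
    let ?F = "\<lambda>s. LINT x|circle. log_norm (\<lambda>j. E - lam * v (fst ((?T' ^^ j) (x, s)))) n"
    \<comment> \<open>The factors are swapped to put the circle variable, which is integrated first,
      in second place. The measurability of \<open>?F\<close> then permits the change of variables
      in the outer integral.\<close>
    have "(\<lambda>(s, x). log_norm (\<lambda>j. E - lam * v (fst ((?T' ^^ j) (x, s)))) n) \<in> borel_measurable (?P \<Otimes>\<^sub>M circle)"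
      using measurable_compose[OF measurable_pair_swap' log_norm_orbit_measurable[OF borel_measurable_continuous_onI[OF contv] T'P]]
      by (simp add: case_prod_beta')
    then have "?F \<in> borel_measurable ?P" by (rule C.borel_measurable_lebesgue_integral)
    then have "(LINT s|M'. ?F s) = (LINT y|M. ?F (h y))"
      unfolding M'_def by (rule integral_distr[OF h])
    then show ?thesis by (simp add: lyapunov_n_eq orbit)
  qed
  then have lyap: "lyapunov M' ?T' v lam E = lyapunov M ?T v lam E" by (simp add: lyapunov_def)
  show "(1 - \<kappa>) * ln lam < lyapunov M ?T v lam E \<and> lyapunov M ?T v lam E < (1 + \<kappa>) * ln lam"
    using valid[unfolded valid_threshold_def, rule_format, OF M' f' g' mp' x hy lam E'] unfolding lyap .
qed

theorem theorem1:
  fixes v :: "real \<Rightarrow> real" and \<kappa> lam E x :: real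
    and M :: "'y measure" and f :: "'y \<Rightarrow> real" and g :: "'y \<Rightarrow> 'y" and y :: 'y
    and T :: "real \<times> 'y \<Rightarrow> real \<times> 'y"
  assumes "real_analytic v" and "periodic1 v" and "\<not> v constant_on UNIV"
    and "\<kappa> > 0"
    and "prob_space M"
    and "f \<in> measurable M circle" and "g \<in> measurable M M"
    and "T = skew_shift f g"
    and "measure_preserving (circle \<Otimes>\<^sub>M M) T"
    and "x \<in> space circle" and "y \<in> space M"
    and "lam > lambda0 v \<kappa>"
    and "complex_of_real E \<in> ell2_spectrum (schroedinger T v lam (x, y))"
  shows "(1 - \<kappa>) * ln lam < lyapunov M T v lam E \<and> lyapunov M T v lam E < (1 + \<kappa>) * ln lam"
proof -
  \<comment> \<open>The choice in \<open>lambda0\<close> is meaningful because a threshold exists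
    over sequence spaces.\<close>
  have "valid_threshold TYPE(nat \<Rightarrow> real) v \<kappa> (lambda0 v \<kappa>)"
    unfolding lambda0_def by (rule someI_ex[OF valid_threshold_exists[OF assms(1-4)]])
  then have "valid_threshold TYPE('y) v \<kappa> (lambda0 v \<kappa>)"
    by (rule valid_threshold_transfer[OF _ real_analytic_continuous_on[OF assms(1,2)]])
  then show ?thesis
    using assms(5-13) unfolding valid_threshold_def by blast
qed

end
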